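(* Let $1<p<\infty$ with $p\neq 2$, and let $\sigma$ be a bijection between the set of trigonometric functions on $[0,1)$ and the set of Walsh functions on $[0,1)$ (that is, a bijection from one of these two sets onto the other). Then $\sigma$ does not extend to an isomorphism $L_p[0,1)\rightarrow L_p[0,1)$; that is, there is no bounded linear bijection $L_p[0,1)\to L_p[0,1)$ with bounded inverse whose restriction to the domain of $\sigma$ equals $\sigma$.
   Context: $L_p[0,1)$ is the complex Lebesgue space with respect to Lebesgue measure. The trigonometric functions are the functions $e_z:[0,1)\to\mathbb{C}$, $e_z(x)=\exp(2\pi i zx)$, for $z\in\mathbb{Z}$. For $j\in\mathbb{N}_0=\{0,1,2,\dots\}$ the $j$th Rademacher function $r_j:[0,1)\to\{-1,1\}$ is defined by $r_j(x)=1$ if and only if $2^jx-\lfloor 2^jx\rfloor<\frac12$. The Walsh functions are the functions $w_J:[0,1)\to\mathbb{C}$, $w_J(x)=\prod_{j\in J}r_j(x)$, for $J\subset\mathbb{N}_0$ finite (with $w_\emptyset=1$). *)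

theory Defs
  imports "HOL-Analysis.Analysis"
begin

section \<open>The complex Lebesgue space \<open>L\<^sub>p[0,1)\<close>\<close>

text \<open>
  The exponent \<open>p\<close> is a real number, so the space is built as a set of equivalence classes
  of functions rather than as a type. Functions on \<open>[0,1)\<close> are represented by
  functions on the reals; only their values on \<open>[0,1)\<close>, the space of the measure, matter.
\<close>

abbreviation leb01 :: "real measure" where
  "leb01 \<equiv> lebesgue_on {0..<1}"

definition Lp_fun :: "real \<Rightarrow> (real \<Rightarrow> complex) set" where
  "Lp_fun p = {f. f \<in> borel_measurable leb01 \<and> integrable leb01 (\<lambda>x. norm (f x) powr p)}"

definition Lp_rel :: "real \<Rightarrow> ((real \<Rightarrow> complex) \<times> (real \<Rightarrow> complex)) set" where
  "Lp_rel p = {(f, g). f \<in> Lp_fun p \<and> g \<in> Lp_fun p \<and> (AE x in leb01. f x = g x)}"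

definition Lp :: "real \<Rightarrow> (real \<Rightarrow> complex) set set" where
  "Lp p = Lp_fun p // Lp_rel p"

definition Lp_class :: "real \<Rightarrow> (real \<Rightarrow> complex) \<Rightarrow> (real \<Rightarrow> complex) set" where
  "Lp_class p f = Lp_rel p `` {f}"

text \<open>
  The operations on classes are given through arbitrary representatives; see
  \<open>Lp_add_class\<close>, \<open>Lp_scale_class\<close> and \<open>Lp_norm_class\<close> below for well-definedness.
\<close>

definition Lp_add ::
  "real \<Rightarrow> (real \<Rightarrow> complex) set \<Rightarrow> (real \<Rightarrow> complex) set \<Rightarrow> (real \<Rightarrow> complex) set" where
  "Lp_add p A B = (\<Union>f\<in>A. \<Union>g\<in>B. Lp_class p (\<lambda>x. f x + g x))"

definition Lp_scale ::
  "real \<Rightarrow> complex \<Rightarrow> (real \<Rightarrow> complex) set \<Rightarrow> (real \<Rightarrow> complex) set" where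
  "Lp_scale p c A = (\<Union>f\<in>A. Lp_class p (\<lambda>x. c * f x))"

definition Lp_norm :: "real \<Rightarrow> (real \<Rightarrow> complex) set \<Rightarrow> real" where
  "Lp_norm p A = the_elem ((\<lambda>f. (LINT x|leb01. norm (f x) powr p) powr (1 / p)) ` A)"

definition Lp_linear ::
  "real \<Rightarrow> ((real \<Rightarrow> complex) set \<Rightarrow> (real \<Rightarrow> complex) set) \<Rightarrow> bool" where
  "Lp_linear p T \<longleftrightarrow>
     T ` Lp p \<subseteq> Lp p \<and>
     (\<forall>A\<in>Lp p. \<forall>B\<in>Lp p. T (Lp_add p A B) = Lp_add p (T A) (T B)) \<and>
     (\<forall>c. \<forall>A\<in>Lp p. T (Lp_scale p c A) = Lp_scale p c (T A))"

definition Lp_bounded ::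
  "real \<Rightarrow> ((real \<Rightarrow> complex) set \<Rightarrow> (real \<Rightarrow> complex) set) \<Rightarrow> bool" where
  "Lp_bounded p T \<longleftrightarrow> (\<exists>C. \<forall>A\<in>Lp p. Lp_norm p (T A) \<le> C * Lp_norm p A)"

definition Lp_isomorphism ::
  "real \<Rightarrow> ((real \<Rightarrow> complex) set \<Rightarrow> (real \<Rightarrow> complex) set) \<Rightarrow> bool" where
  "Lp_isomorphism p T \<longleftrightarrow>
     Lp_linear p T \<and> Lp_bounded p T \<and> bij_betw T (Lp p) (Lp p) \<and>
     Lp_bounded p (inv_into (Lp p) T)"


section \<open>Trigonometric and Walsh functions\<close>

definition trig :: "int \<Rightarrow> real \<Rightarrow> complex" where
  "trig z = (\<lambda>x\<in>{0..<1}. exp (2 * of_real pi * \<i> * of_int z * of_real x))"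

definition rademacher :: "nat \<Rightarrow> real \<Rightarrow> real" where
  "rademacher j x = (if 2 ^ j * x - of_int \<lfloor>2 ^ j * x\<rfloor> < 1 / 2 then 1 else - 1)"

definition walsh :: "nat set \<Rightarrow> real \<Rightarrow> complex" where
  "walsh J = (\<lambda>x\<in>{0..<1}. \<Prod>j\<in>J. of_real (rademacher j x))"

definition trig_functions :: "(real \<Rightarrow> complex) set" where
  "trig_functions = range trig"

definition walsh_functions :: "(real \<Rightarrow> complex) set" where
  "walsh_functions = walsh ` {J. finite J}"


section \<open>Well-definedness\<close>

lemma equiv_Lp_rel: "equiv (Lp_fun p) (Lp_rel p)"
  unfolding equiv_def
proof (intro conjI)
  show "Lp_rel p \<subseteq> Lp_fun p \<times> Lp_fun p" by (auto simp: Lp_rel_def)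
  show "refl_on (Lp_fun p) (Lp_rel p)" by (auto simp: refl_on_def Lp_rel_def)
  show "sym (Lp_rel p)" by (simp add: sym_def Lp_rel_def eq_commute)
  show "trans (Lp_rel p)"
  proof (rule transI)
    fix f g h assume "(f, g) \<in> Lp_rel p" "(g, h) \<in> Lp_rel p"
    moreover have "AE x in leb01. f x = h x"
      if "AE x in leb01. f x = g x" "AE x in leb01. g x = h x"
      using that by eventually_elim simp
    ultimately show "(f, h) \<in> Lp_rel p" by (auto simp: Lp_rel_def)
  qed
qed

lemma mem_Lp_class_iff:
  "g \<in> Lp_class p f \<longleftrightarrow> f \<in> Lp_fun p \<and> g \<in> Lp_fun p \<and> (AE x in leb01. f x = g x)"
  by (auto simp: Lp_class_def Lp_rel_def)

lemma Lp_class_self: "f \<in> Lp_fun p \<Longrightarrow> f \<in> Lp_class p f"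
  by (simp add: mem_Lp_class_iff)

lemma Lp_class_in_Lp: "f \<in> Lp_fun p \<Longrightarrow> Lp_class p f \<in> Lp p"
  by (auto simp: Lp_class_def Lp_def quotientI)

lemma Lp_classE:
  assumes "A \<in> Lp p"
  obtains f where "f \<in> Lp_fun p" "A = Lp_class p f"
  using assms by (auto simp: Lp_class_def Lp_def elim: quotientE)

lemma Lp_class_eqI:
  assumes "f \<in> Lp_fun p" "g \<in> Lp_fun p" "AE x in leb01. f x = g x"
  shows "Lp_class p f = Lp_class p g"
  unfolding Lp_class_def
  by (rule equiv_class_eq[OF equiv_Lp_rel]) (use assms in \<open>auto simp: Lp_rel_def\<close>)

lemma Lp_fun_add:
  assumes p: "p > 0" and f: "f \<in> Lp_fun p" and g: "g \<in> Lp_fun p"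
  shows "(\<lambda>x. f x + g x) \<in> Lp_fun p"
proof -
  have [measurable]: "f \<in> borel_measurable leb01" "g \<in> borel_measurable leb01"
    using f g by (auto simp: Lp_fun_def)
  have bound: "norm (a + b) powr p \<le> 2 powr p * (norm a powr p + norm b powr p)" for a b :: complex
  proof -
    have "norm (a + b) \<le> 2 * max (norm a) (norm b)"
      using norm_triangle_ineq[of a b] by linarith
    hence "norm (a + b) powr p \<le> (2 * max (norm a) (norm b)) powr p"
      using p by (intro powr_mono2) auto
    also have "\<dots> = 2 powr p * max (norm a) (norm b) powr p"
      by (rule powr_mult)
    also have "\<dots> \<le> 2 powr p * (norm a powr p + norm b powr p)"
      by (intro mult_left_mono) (auto simp: max_def)
    finally show ?thesis .
  qed
  have "integrable leb01 (\<lambda>x. norm (f x + g x) powr p)"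
  proof (rule Bochner_Integration.integrable_bound)
    show "integrable leb01 (\<lambda>x. 2 powr p * (norm (f x) powr p + norm (g x) powr p))"
      using f g by (auto simp: Lp_fun_def)
    show "(\<lambda>x. norm (f x + g x) powr p) \<in> borel_measurable leb01" by measurable
    show "AE x in leb01. norm (norm (f x + g x) powr p)
            \<le> norm (2 powr p * (norm (f x) powr p + norm (g x) powr p))"
      by (intro AE_I2) (use bound in \<open>simp add: order_trans[OF _ abs_ge_self]\<close>)
  qed
  thus ?thesis by (simp add: Lp_fun_def)
qed

lemma Lp_fun_scale:
  assumes "f \<in> Lp_fun p"
  shows "(\<lambda>x. c * f x) \<in> Lp_fun p"
  using assms by (auto simp: Lp_fun_def norm_mult powr_mult)

lemma Lp_add_class:
  assumes "p > 0" "f \<in> Lp_fun p" "g \<in> Lp_fun p"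
  shows "Lp_add p (Lp_class p f) (Lp_class p g) = Lp_class p (\<lambda>x. f x + g x)"
proof -
  have "Lp_class p (\<lambda>x. f' x + g' x) = Lp_class p (\<lambda>x. f x + g x)"
    if "f' \<in> Lp_class p f" "g' \<in> Lp_class p g" for f' g'
  proof (rule Lp_class_eqI)
    have "AE x in leb01. f x = f' x" "AE x in leb01. g x = g' x"
      using that by (auto simp: mem_Lp_class_iff)
    thus "AE x in leb01. f' x + g' x = f x + g x" by eventually_elim simp
  qed (use that assms in \<open>auto simp: mem_Lp_class_iff intro: Lp_fun_add\<close>)
  moreover have "f \<in> Lp_class p f" "g \<in> Lp_class p g"
    using assms by (auto simp: Lp_class_self)
  ultimately show ?thesis unfolding Lp_add_def by blast
qed

lemma Lp_scale_class:
  assumes "f \<in> Lp_fun p"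
  shows "Lp_scale p c (Lp_class p f) = Lp_class p (\<lambda>x. c * f x)"
proof -
  have "Lp_class p (\<lambda>x. c * f' x) = Lp_class p (\<lambda>x. c * f x)" if "f' \<in> Lp_class p f" for f'
  proof (rule Lp_class_eqI)
    have "AE x in leb01. f x = f' x" using that by (auto simp: mem_Lp_class_iff)
    thus "AE x in leb01. c * f' x = c * f x" by eventually_elim simp
  qed (use that assms in \<open>auto simp: mem_Lp_class_iff intro: Lp_fun_scale\<close>)
  moreover have "f \<in> Lp_class p f" using assms by (auto simp: Lp_class_self)
  ultimately show ?thesis unfolding Lp_scale_def by blast
qed

lemma Lp_norm_class:
  assumes "f \<in> Lp_fun p"
  shows "Lp_norm p (Lp_class p f) = (LINT x|leb01. norm (f x) powr p) powr (1 / p)"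
proof -
  have "(LINT x|leb01. norm (g x) powr p) = (LINT x|leb01. norm (f x) powr p)"
    if "g \<in> Lp_class p f" for g
  proof (rule integral_cong_AE)
    have "f \<in> borel_measurable leb01" "g \<in> borel_measurable leb01" "AE x in leb01. f x = g x"
      using that by (auto simp: mem_Lp_class_iff Lp_fun_def)
    note [measurable] = this(1,2) and ae = this(3)
    show "(\<lambda>x. norm (g x) powr p) \<in> borel_measurable leb01" by measurable
    show "(\<lambda>x. norm (f x) powr p) \<in> borel_measurable leb01" by measurable
    show "AE x in leb01. norm (g x) powr p = norm (f x) powr p"
      using ae by eventually_elim simp
  qed
  hence "(\<lambda>f. (LINT x|leb01. norm (f x) powr p) powr (1 / p)) ` Lp_class p f
           = (\<lambda>_. (LINT x|leb01. norm (f x) powr p) powr (1 / p)) ` Lp_class p f"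
    by (intro image_cong refl) simp
  also have "\<dots> = {(LINT x|leb01. norm (f x) powr p) powr (1 / p)}"
    using Lp_class_self[OF assms] by (intro image_constant)
  finally show ?thesis by (simp add: Lp_norm_def)
qed

lemma unimodular_in_Lp_fun:
  assumes "f \<in> borel_measurable leb01" "\<And>x. x \<in> {0..<1} \<Longrightarrow> norm (f x) = 1"
  shows "f \<in> Lp_fun p"
proof -
  have "integrable leb01 (\<lambda>x. norm (f x) powr p) \<longleftrightarrow> integrable leb01 (\<lambda>x. 1 :: real)"
    by (rule Bochner_Integration.integrable_cong) (use assms(2) in \<open>auto simp: space_restrict_space\<close>)
  also have "integrable leb01 (\<lambda>x. 1 :: real)"
    by (intro finite_measure.integrable_const finite_measure_lebesgue_on
        bounded_set_imp_lmeasurable bounded_Ico) simp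
  finally show ?thesis using assms(1) by (simp add: Lp_fun_def)
qed

lemma trig_functions_subset: "trig_functions \<subseteq> Lp_fun p"
proof -
  have "trig z \<in> Lp_fun p" for z
  proof (rule unimodular_in_Lp_fun)
    have "(\<lambda>x. exp (2 * of_real pi * \<i> * of_int z * of_real x) :: complex) \<in> borel_measurable borel"
      by (intro borel_measurable_continuous_onI continuous_intros)
    hence "(\<lambda>x. exp (2 * of_real pi * \<i> * of_int z * of_real x) :: complex)
            \<in> borel_measurable leb01"
      by (intro measurable_restrict_space1) (auto intro: measurable_completion)
    thus "trig z \<in> borel_measurable leb01"
      by (subst measurable_cong[of _ _ "\<lambda>x. exp (2 * of_real pi * \<i> * of_int z * of_real x)"])
         (auto simp: trig_def space_restrict_space)
    show "norm (trig z x) = 1" if "x \<in> {0..<1}" for x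
      using that by (simp add: trig_def norm_exp_eq_Re)
  qed
  thus ?thesis by (auto simp: trig_functions_def)
qed

lemma walsh_functions_subset: "walsh_functions \<subseteq> Lp_fun p"
proof -
  have "walsh J \<in> Lp_fun p" if "finite J" for J
  proof (rule unimodular_in_Lp_fun)
    have "(\<lambda>x. \<Prod>j\<in>J. of_real (rademacher j x) :: complex) \<in> borel_measurable borel"
      unfolding rademacher_def by measurable
    hence "(\<lambda>x. \<Prod>j\<in>J. of_real (rademacher j x) :: complex) \<in> borel_measurable leb01"
      by (intro measurable_restrict_space1) (auto intro: measurable_completion)
    thus "walsh J \<in> borel_measurable leb01"
      by (subst measurable_cong[of _ _ "\<lambda>x. \<Prod>j\<in>J. of_real (rademacher j x)"])
         (auto simp: walsh_def space_restrict_space)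
    show "norm (walsh J x) = 1" if "x \<in> {0..<1}" for x
      using that by (auto simp: walsh_def prod_norm[symmetric] rademacher_def intro!: prod.neutral)
  qed
  thus ?thesis by (auto simp: walsh_functions_def)
qed

end

theory Submission
  imports Defs
begin

text \<open>
  Translating by \<open>k / L\<close> on the trigonometric side is an isometry, so an isomorphism makes the unimodular
  functions \<open>J \<mapsto> cis (2 * pi * k * F J / L)\<close> uniformly bounded Walsh multipliers on every finite cube,
  where \<open>walsh J\<close> is paired with \<open>trig (F J)\<close>. As \<open>p \<noteq> 2\<close>, their Walsh coefficients are uniformly
  summable to some power below 2, so each of them is essentially a combination of boundedly many Walsh
  functions, and the mean \<open>Q\<close> over \<open>k\<close> of the fourth powers of the coefficients is bounded below.

  The square of the \<open>k\<close>-th multiplier is the \<open>2 * k\<close>-th one, whose coefficient at \<open>{}\<close> is small on average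
  because \<open>F\<close> is injective, while the Walsh group has exponent 2; this forces \<open>Q \<le> 3 / 4\<close>.

  If two characters differing by a fixed \<open>d \<noteq> {}\<close> occur together in many multipliers, then passing to a
  coset of the annihilator of \<open>d\<close> increases \<open>Q\<close>. After boundedly many steps no such \<open>d\<close> is left. Then
  the spectra of two typical multipliers are independent, the coefficients of their product are
  essentially products of coefficients, and \<open>Q\<close> is nearly \<open>Q\<^sup>2\<close>, contradicting the bounds on \<open>Q\<close>.
\<close>

section \<open>Fourier analysis on the cube\<close>


definition sd :: "'a set \<Rightarrow> 'a set \<Rightarrow> 'a set" (infixl "\<oplus>" 65) where
  "A \<oplus> B = (A - B) \<union> (B - A)"

lemma sd_simps [simp]: "A \<oplus> {} = A" "{} \<oplus> A = A" "A \<oplus> A = {}" "(A \<oplus> B) \<oplus> B = A"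
  "B \<oplus> (B \<oplus> A) = A"
  by (auto simp: sd_def)

lemma sd_commute: "A \<oplus> B = B \<oplus> A"
  by (auto simp: sd_def)

lemma sd_eq_empty_iff [simp]: "A \<oplus> B = {} \<longleftrightarrow> A = B"
  by (auto simp: sd_def)

lemma sd_subset: "A \<subseteq> I \<Longrightarrow> B \<subseteq> I \<Longrightarrow> A \<oplus> B \<subseteq> I"
  by (auto simp: sd_def)

text \<open>For finite \<open>J\<close> this is (-1)^|x \<inter> J|, a symmetric pairing of finite
  sets with themselves. Points \<open>x\<close> of the cube and indices \<open>J\<close> of Walsh
  functions are therefore both subsets of \<open>I\<close> and can exchange roles.\<close>

definition wal :: "'a set \<Rightarrow> 'a set \<Rightarrow> real" where
  "wal x J = (\<Prod>j\<in>J. if j \<in> x then -1 else 1)"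

lemma wal_sd_left: "wal (x \<oplus> y) J = wal x J * wal y J"
  unfolding wal_def prod.distrib[symmetric] by (rule prod.cong) (auto simp: sd_def)

lemma wal_commute:
  assumes "finite x" "finite J"
  shows "wal x J = wal J x"
proof -
  have *: "wal x J = (\<Prod>j\<in>x \<inter> J. -1)" if "finite J" for x J :: "'a set"
  proof -
    have "wal x J = (\<Prod>j\<in>J. if j \<in> x \<inter> J then -1 else 1)"
      unfolding wal_def by (rule prod.cong) auto
    also have "\<dots> = (\<Prod>j\<in>J \<inter> (x \<inter> J). -1)"
      using that by (subst prod.inter_restrict) auto
    also have "J \<inter> (x \<inter> J) = x \<inter> J" by auto
    finally show ?thesis .
  qed
  show ?thesis using *[of J x] *[of x J] assms by (simp add: Int_commute)
qed

lemma wal_sd_right: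
  assumes "finite x" "finite J" "finite K"
  shows "wal x (J \<oplus> K) = wal x J * wal x K"
proof -
  have "finite (J \<oplus> K)" using assms by (simp add: sd_def)
  thus ?thesis using assms by (simp add: wal_commute[of x] wal_sd_left)
qed

lemma wal_empty [simp]: "wal {} J = 1" "wal x {} = 1"
  by (simp_all add: wal_def)

lemma abs_wal [simp]: "\<bar>wal x J\<bar> = 1"
  unfolding wal_def by (auto simp: abs_prod intro!: prod.neutral)

lemma sum_Pow_sd:
  assumes "a \<subseteq> I"
  shows "(\<Sum>J\<in>Pow I. f (J \<oplus> a)) = (\<Sum>J\<in>Pow I. f J)"
  by (rule sum.reindex_bij_witness[of _ "\<lambda>J. J \<oplus> a" "\<lambda>J. J \<oplus> a"])
     (use assms in \<open>simp_all add: sd_subset\<close>)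

text \<open>Flipping the membership of one \<open>i \<in> x\<close> permutes the cube and negates
  the character, so a nontrivial character sums to zero.\<close>

lemma sum_wal:
  assumes "finite I" "x \<subseteq> I"
  shows "(\<Sum>J\<in>Pow I. wal x J) = (if x = {} then 2 ^ card I else 0)"
proof (cases "x = {}")
  case True
  thus ?thesis using assms by (simp add: card_Pow)
next
  case False
  then obtain i where i: "i \<in> x" by auto
  have "(\<Sum>J\<in>Pow I. wal x J) = (\<Sum>J\<in>Pow I. wal x (J \<oplus> {i}))"
    using i assms by (intro sum_Pow_sd[symmetric]) auto
  also have "\<dots> = (\<Sum>J\<in>Pow I. - wal x J)"
  proof (rule sum.cong)
    fix J assume "J \<in> Pow I"
    hence "finite J" "finite x" using assms finite_subset by auto
    moreover have "wal x {i} = -1" using i by (simp add: wal_def)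
    ultimately show "wal x (J \<oplus> {i}) = - wal x J" by (simp add: wal_sd_right)
  qed simp
  finally show ?thesis using False by (simp add: sum_negf)
qed

lemma sum_wal_mult:
  assumes "finite I" "x \<subseteq> I" "y \<subseteq> I"
  shows "(\<Sum>J\<in>Pow I. wal x J * wal y J) = (if x = y then 2 ^ card I else 0)"
  using sum_wal[OF assms(1) sd_subset[OF assms(2,3)]] by (simp add: wal_sd_left)

section \<open>Fourier coefficients, inversion and Plancherel on the finite cube\<close>

definition hat :: "'a set \<Rightarrow> ('a set \<Rightarrow> complex) \<Rightarrow> 'a set \<Rightarrow> complex" where
  "hat I g x = (\<Sum>J\<in>Pow I. g J * wal x J) / 2 ^ card I"

lemma hat_cong: "(\<And>J. J \<subseteq> I \<Longrightarrow> f J = g J) \<Longrightarrow> hat I f x = hat I g x"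
  by (simp add: hat_def)

lemma hat_synthesis:
  fixes c :: "'a set \<Rightarrow> complex"
  assumes "finite I" "x \<subseteq> I"
  shows "hat I (\<lambda>J. \<Sum>y\<in>Pow I. c y * wal y J) x = c x"
proof -
  have "(\<Sum>J\<in>Pow I. (\<Sum>y\<in>Pow I. c y * wal y J) * wal x J)
      = (\<Sum>J\<in>Pow I. \<Sum>y\<in>Pow I. c y * complex_of_real (wal y J * wal x J))"
    by (simp add: sum_distrib_right mult.assoc)
  also have "\<dots> = (\<Sum>y\<in>Pow I. \<Sum>J\<in>Pow I. c y * complex_of_real (wal y J * wal x J))"
    by (rule sum.swap)
  also have "\<dots> = (\<Sum>y\<in>Pow I. c y * complex_of_real (\<Sum>J\<in>Pow I. wal y J * wal x J))"
    unfolding of_real_sum sum_distrib_left ..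
  also have "\<dots> = (\<Sum>y\<in>Pow I. if y = x then c y * 2 ^ card I else 0)"
    using assms by (intro sum.cong) (auto simp: sum_wal_mult)
  also have "\<dots> = c x * 2 ^ card I"
    using assms by (simp add: sum.delta)
  finally show ?thesis by (simp add: hat_def)
qed

lemma hat_inversion:
  assumes "finite I" "J \<subseteq> I"
  shows "g J = (\<Sum>x\<in>Pow I. hat I g x * wal x J)"
proof -
  have fin: "finite K" if "K \<subseteq> I" for K using that assms finite_subset by blast
  have "(\<Sum>x\<in>Pow I. (\<Sum>K\<in>Pow I. g K * wal x K) * wal x J)
      = (\<Sum>x\<in>Pow I. \<Sum>K\<in>Pow I. g K * complex_of_real (wal K x * wal J x))"
    using assms fin by (simp add: sum_distrib_right mult.assoc wal_commute)
  also have "\<dots> = (\<Sum>K\<in>Pow I. \<Sum>x\<in>Pow I. g K * complex_of_real (wal K x * wal J x))"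
    by (rule sum.swap)
  also have "\<dots> = (\<Sum>K\<in>Pow I. g K * complex_of_real (\<Sum>x\<in>Pow I. wal K x * wal J x))"
    unfolding of_real_sum sum_distrib_left ..
  also have "\<dots> = (\<Sum>K\<in>Pow I. if K = J then g K * 2 ^ card I else 0)"
    using assms by (intro sum.cong) (auto simp: sum_wal_mult)
  also have "\<dots> = g J * 2 ^ card I"
    using assms by (simp add: sum.delta)
  finally have "g J = (\<Sum>x\<in>Pow I. (\<Sum>K\<in>Pow I. g K * wal x K) * wal x J) / 2 ^ card I" by simp
  also have "\<dots> = (\<Sum>x\<in>Pow I. hat I g x * wal x J)"
    by (subst sum_divide_distrib) (simp add: hat_def)
  finally show ?thesis .
qed

text \<open>Only the shifted factor is expanded; its characters split as
  \<open>wal x h * wal x a\<close>, and the sum over \<open>h\<close> becomes a coefficient of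
  \<open>f\<close>. The case \<open>a = {}\<close> yields Plancherel, \<open>f = g\<close> the
  autocorrelation, a modulated \<open>f\<close> the twisted one.\<close>

lemma corr_eq:
  assumes "finite I" "a \<subseteq> I"
  shows "(\<Sum>h\<in>Pow I. f h * cnj (g (h \<oplus> a))) / 2 ^ card I
       = (\<Sum>x\<in>Pow I. hat I f x * cnj (hat I g x) * wal x a)"
proof -
  have fin: "finite K" if "K \<subseteq> I" for K using that assms finite_subset by blast
  have "(\<Sum>h\<in>Pow I. f h * cnj (g (h \<oplus> a)))
      = (\<Sum>h\<in>Pow I. \<Sum>x\<in>Pow I. cnj (hat I g x) * wal x a * (f h * wal x h))"
  proof (rule sum.cong)
    fix h assume h: "h \<in> Pow I"
    have "g (h \<oplus> a) = (\<Sum>x\<in>Pow I. hat I g x * wal x (h \<oplus> a))"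
      using h assms by (intro hat_inversion sd_subset) auto
    also have "\<dots> = (\<Sum>x\<in>Pow I. hat I g x * (wal x h * wal x a))"
      using h assms fin by (intro sum.cong) (auto simp: wal_sd_right)
    finally show "f h * cnj (g (h \<oplus> a)) = (\<Sum>x\<in>Pow I. cnj (hat I g x) * wal x a * (f h * wal x h))"
      by (simp add: sum_distrib_left mult_ac)
  qed simp
  also have "\<dots> = (\<Sum>x\<in>Pow I. \<Sum>h\<in>Pow I. cnj (hat I g x) * wal x a * (f h * wal x h))"
    by (rule sum.swap)
  also have "\<dots> = (\<Sum>x\<in>Pow I. cnj (hat I g x) * wal x a * (hat I f x * 2 ^ card I))"
    by (simp add: hat_def sum_distrib_left)
  also have "\<dots> = (\<Sum>x\<in>Pow I. hat I f x * cnj (hat I g x) * wal x a) * 2 ^ card I"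
    by (simp add: sum_distrib_left sum_distrib_right mult_ac)
  finally show ?thesis by simp
qed

lemma plancherel:
  assumes "finite I"
  shows "(\<Sum>h\<in>Pow I. (cmod (g h))\<^sup>2) / 2 ^ card I = (\<Sum>x\<in>Pow I. (cmod (hat I g x))\<^sup>2)"
proof -
  have "complex_of_real ((\<Sum>h\<in>Pow I. (cmod (g h))\<^sup>2) / 2 ^ card I)
      = complex_of_real (\<Sum>x\<in>Pow I. (cmod (hat I g x))\<^sup>2)"
    using corr_eq[OF assms, of "{}" g g] unfolding of_real_sum of_real_divide complex_norm_square by simp
  thus ?thesis by (simp only: of_real_eq_iff)
qed

text \<open>Serves functions given by an explicit Walsh expansion, whose coefficients must be the
  Fourier coefficients by uniqueness.\<close>

lemma plancherel_synthesis:
  fixes c :: "'a set \<Rightarrow> complex"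
  assumes "finite I" "\<And>a. a \<subseteq> I \<Longrightarrow> f a = (\<Sum>x\<in>Pow I. c x * wal x a)"
  shows "(\<Sum>a\<in>Pow I. (cmod (f a))\<^sup>2) / 2 ^ card I = (\<Sum>x\<in>Pow I. (cmod (c x))\<^sup>2)"
proof -
  have "hat I f x = c x" if "x \<subseteq> I" for x
    using hat_cong[of I f "\<lambda>J. \<Sum>y\<in>Pow I. c y * wal y J" x] hat_synthesis[OF assms(1) that] assms(2)
    by simp
  thus ?thesis unfolding plancherel[OF assms(1)] by (intro sum.cong) auto
qed

section \<open>Correlations and spectral energies\<close>

lemma hat_wal_mult:
  "hat I (\<lambda>J. g J * complex_of_real (wal d J)) x = hat I g (x \<oplus> d)"
  by (simp add: hat_def wal_sd_left mult_ac)

definition auto_corr :: "'a set \<Rightarrow> ('a set \<Rightarrow> complex) \<Rightarrow> 'a set \<Rightarrow> complex" where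
  "auto_corr I g a = (\<Sum>h\<in>Pow I. g h * cnj (g (h \<oplus> a))) / 2 ^ card I"

text \<open>The twist by \<open>wal d\<close> pairs each frequency with its translate by
  \<open>d\<close>; \<open>d = {}\<close> gives \<open>auto_corr\<close>.\<close>

definition twist_corr :: "'a set \<Rightarrow> ('a set \<Rightarrow> complex) \<Rightarrow> 'a set \<Rightarrow> 'a set \<Rightarrow> complex" where
  "twist_corr I g d a = (\<Sum>h\<in>Pow I. g h * cnj (g (h \<oplus> a)) * wal d h) / 2 ^ card I"

text \<open>For unimodular \<open>g\<close> the squared coefficients form a probability
  distribution, and this is the probability that two independent samples differ by \<open>d\<close>.
  At \<open>d = {}\<close> it is the sum of the fourth powers, the fourth power of the Gowers U^2
  norm.\<close>

definition spec_energy :: "'a set \<Rightarrow> ('a set \<Rightarrow> complex) \<Rightarrow> 'a set \<Rightarrow> real" where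
  "spec_energy I g d = (\<Sum>x\<in>Pow I. (cmod (hat I g x))\<^sup>2 * (cmod (hat I g (x \<oplus> d)))\<^sup>2)"

lemma auto_corr_eq:
  assumes "finite I" "a \<subseteq> I"
  shows "auto_corr I g a = (\<Sum>x\<in>Pow I. complex_of_real ((cmod (hat I g x))\<^sup>2) * wal x a)"
  using corr_eq[OF assms, of g g] by (simp add: auto_corr_def complex_norm_square del: of_real_power)

lemma twist_corr_eq:
  assumes "finite I" "a \<subseteq> I"
  shows "twist_corr I g d a = (\<Sum>x\<in>Pow I. hat I g (x \<oplus> d) * cnj (hat I g x) * wal x a)"
  using corr_eq[OF assms, of "\<lambda>J. g J * complex_of_real (wal d J)" g]
  unfolding hat_wal_mult by (simp add: twist_corr_def mult_ac)

lemma twist_corr_L2: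
  assumes "finite I"
  shows "(\<Sum>a\<in>Pow I. (cmod (twist_corr I g d a))\<^sup>2) / 2 ^ card I = spec_energy I g d"
  using plancherel_synthesis[OF assms twist_corr_eq[OF assms], of g d]
  by (simp add: spec_energy_def norm_mult power_mult_distrib mult_ac)

lemma auto_corr_L2:
  assumes "finite I"
  shows "(\<Sum>a\<in>Pow I. (cmod (auto_corr I g a))\<^sup>2) / 2 ^ card I = spec_energy I g {}"
  using twist_corr_L2[OF assms, of g "{}"] by (simp add: twist_corr_def auto_corr_def)

text \<open>The autocorrelation is the real transform of the squared coefficients, so its square is
  the transform of their convolution over \<open>\<oplus>\<close>, which is
  \<open>spec_energy\<close>.\<close>

lemma auto_corr_norm_sq:
  assumes "finite I" "a \<subseteq> I"
  shows "(cmod (auto_corr I g a))\<^sup>2 = (\<Sum>d\<in>Pow I. spec_energy I g d * wal d a)"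
proof -
  let ?u = "\<lambda>x. (cmod (hat I g x))\<^sup>2"
  let ?r = "\<Sum>x\<in>Pow I. ?u x * wal x a"
  have "auto_corr I g a = complex_of_real ?r"
    by (simp add: auto_corr_eq[OF assms])
  hence "(cmod (auto_corr I g a))\<^sup>2 = ?r * ?r"
    by (simp only: norm_of_real power2_abs power2_eq_square abs_mult_self_eq)
  also have "\<dots> = (\<Sum>x\<in>Pow I. \<Sum>y\<in>Pow I. ?u x * ?u y * wal (x \<oplus> y) a)"
    by (simp add: sum_product wal_sd_left mult_ac)
  also have "\<dots> = (\<Sum>x\<in>Pow I. \<Sum>d\<in>Pow I. ?u x * ?u (x \<oplus> d) * wal d a)"
  proof (rule sum.cong)
    fix x assume "x \<in> Pow I"
    hence "(\<Sum>y\<in>Pow I. ?u x * ?u y * wal (x \<oplus> y) a)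
      = (\<Sum>d\<in>Pow I. ?u x * ?u (d \<oplus> x) * wal (x \<oplus> (d \<oplus> x)) a)"
      by (intro sum_Pow_sd[symmetric]) auto
    also have "\<dots> = (\<Sum>d\<in>Pow I. ?u x * ?u (x \<oplus> d) * wal d a)"
      by (simp add: sd_commute[of _ x])
    finally show "(\<Sum>y\<in>Pow I. ?u x * ?u y * wal (x \<oplus> y) a) = \<dots>" .
  qed simp
  also have "\<dots> = (\<Sum>d\<in>Pow I. \<Sum>x\<in>Pow I. ?u x * ?u (x \<oplus> d) * wal d a)"
    by (rule sum.swap)
  finally show ?thesis by (simp add: spec_energy_def sum_distrib_right)
qed

lemma spec_energy_nonneg: "spec_energy I g d \<ge> 0"
  by (simp add: spec_energy_def sum_nonneg)

section \<open>Unimodular functions\<close>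

definition unimod :: "'a set \<Rightarrow> ('a set \<Rightarrow> complex) \<Rightarrow> bool" where
  "unimod I g \<longleftrightarrow> (\<forall>J\<subseteq>I. cmod (g J) = 1)"

lemma unimod_hat_L2:
  assumes "finite I" "unimod I g"
  shows "(\<Sum>x\<in>Pow I. (cmod (hat I g x))\<^sup>2) = 1"
  using plancherel[OF assms(1), of g] assms by (simp add: unimod_def card_Pow)

lemma sum_spec_energy:
  assumes "finite I" "unimod I g"
  shows "(\<Sum>d\<in>Pow I. spec_energy I g d) = 1"
proof -
  let ?u = "\<lambda>x. (cmod (hat I g x))\<^sup>2"
  have "(\<Sum>d\<in>Pow I. spec_energy I g d) = (\<Sum>x\<in>Pow I. \<Sum>d\<in>Pow I. ?u x * ?u (d \<oplus> x))"
    unfolding spec_energy_def by (subst sum.swap) (simp add: sd_commute)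
  also have "\<dots> = (\<Sum>x\<in>Pow I. \<Sum>d\<in>Pow I. ?u x * ?u d)"
    by (intro sum.cong[OF refl] sum_Pow_sd) auto
  also have "\<dots> = 1" using unimod_hat_L2[OF assms] by (simp flip: sum_product)
  finally show ?thesis .
qed

lemma sum_Pow_abs_le:
  assumes "finite I"
  shows "(\<Sum>a\<in>Pow I. \<bar>f a\<bar>) / 2 ^ card I \<le> sqrt ((\<Sum>a\<in>Pow I. (f a)\<^sup>2) / 2 ^ card I)"
proof (rule real_le_rsqrt)
  have "(\<Sum>a\<in>Pow I. \<bar>f a\<bar> * 1)\<^sup>2 \<le> (\<Sum>a\<in>Pow I. \<bar>f a\<bar>\<^sup>2) * (\<Sum>a\<in>Pow I. 1\<^sup>2)"
    by (rule Cauchy_Schwarz_ineq_sum)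
  thus "((\<Sum>a\<in>Pow I. \<bar>f a\<bar>) / 2 ^ card I)\<^sup>2 \<le> (\<Sum>a\<in>Pow I. (f a)\<^sup>2) / 2 ^ card I"
    using assms by (simp add: card_Pow power_divide field_simps power2_eq_square)
qed


lemma unimod_autocorr_le_1:
  assumes "finite I" "unimod I g" "a \<subseteq> I"
  shows "cmod (auto_corr I g a) \<le> 1"
proof -
  have "cmod (\<Sum>h\<in>Pow I. g h * cnj (g (h \<oplus> a))) \<le> (\<Sum>h\<in>Pow I. 1)"
    by (rule sum_norm_le)
       (use assms sd_subset[of _ I a] in \<open>auto simp: norm_mult unimod_def\<close>)
  thus ?thesis using assms(1) by (simp add: auto_corr_def norm_divide norm_power card_Pow)
qed

lemma unimod_hat_le_1:
  assumes "finite I" "unimod I g" "x \<subseteq> I"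
  shows "cmod (hat I g x) \<le> 1"
proof -
  have "(cmod (hat I g x))\<^sup>2 \<le> 1"
    using member_le_sum[of x "Pow I" "\<lambda>x. (cmod (hat I g x))\<^sup>2"] unimod_hat_L2[OF assms(1,2)] assms
    by auto
  thus ?thesis by (simp add: power_le_one_iff abs_square_le_1)
qed

text \<open>Walsh characters are real, so Parseval also holds without conjugates. The right-hand
  side is the coefficient of the squared function at \<open>{}\<close>.\<close>

lemma sum_hat_sq:
  assumes "finite I"
  shows "(\<Sum>x\<in>Pow I. (hat I g x)\<^sup>2) = (\<Sum>J\<in>Pow I. (g J)\<^sup>2) / 2 ^ card I"
proof -
  have "(\<Sum>J\<in>Pow I. (g J)\<^sup>2) = (\<Sum>J\<in>Pow I. \<Sum>x\<in>Pow I. hat I g x * (g J * wal x J))"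
  proof (rule sum.cong)
    fix J assume "J \<in> Pow I"
    hence "g J * g J = g J * (\<Sum>x\<in>Pow I. hat I g x * wal x J)"
      using hat_inversion[OF assms, of J g] by simp
    thus "(g J)\<^sup>2 = (\<Sum>x\<in>Pow I. hat I g x * (g J * wal x J))"
      by (simp add: power2_eq_square sum_distrib_left mult_ac)
  qed simp
  also have "\<dots> = (\<Sum>x\<in>Pow I. hat I g x * (\<Sum>J\<in>Pow I. g J * wal x J))"
    by (subst sum.swap) (simp add: sum_distrib_left)
  also have "\<dots> = (\<Sum>x\<in>Pow I. hat I g x * (hat I g x * 2 ^ card I))"
    by (simp add: hat_def)
  also have "\<dots> = (\<Sum>x\<in>Pow I. (hat I g x)\<^sup>2) * 2 ^ card I"
    by (simp add: sum_distrib_left sum_distrib_right power2_eq_square mult_ac)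
  finally show ?thesis by simp
qed

text \<open>If one coefficient has mass \<open>u\<close>, only the remaining mass 1 - u can cancel
  it in the sum \<open>E\<close> of squares, so u \<le> |E| + 1 - u. The energy is the average of
  these masses, weighted by themselves.\<close>

lemma spec_energy_le_sum_hat_sq:
  assumes "finite I" "unimod I g"
  shows "spec_energy I g {} \<le> (1 + cmod (\<Sum>x\<in>Pow I. (hat I g x)\<^sup>2)) / 2"
proof -
  let ?u = "\<lambda>x. (cmod (hat I g x))\<^sup>2" and ?E = "\<Sum>x\<in>Pow I. (hat I g x)\<^sup>2"
  have bd: "?u x \<le> (1 + cmod ?E) / 2" if x: "x \<in> Pow I" for x
  proof -
    have fin: "finite (Pow I)" using assms by simp
    have "(hat I g x)\<^sup>2 = ?E - (\<Sum>y\<in>Pow I - {x}. (hat I g y)\<^sup>2)"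
      using sum.remove[OF fin x, of "\<lambda>x. (hat I g x)\<^sup>2"] by simp
    hence "?u x \<le> cmod ?E + cmod (\<Sum>y\<in>Pow I - {x}. (hat I g y)\<^sup>2)"
      by (metis norm_power norm_triangle_ineq4)
    also have "cmod (\<Sum>y\<in>Pow I - {x}. (hat I g y)\<^sup>2) \<le> (\<Sum>y\<in>Pow I - {x}. ?u y)"
      by (rule sum_norm_le) (simp add: norm_power)
    also have "\<dots> = 1 - ?u x"
      using sum.remove[OF fin x, of ?u] unimod_hat_L2[OF assms] by simp
    finally show ?thesis by simp
  qed
  have "spec_energy I g {} = (\<Sum>x\<in>Pow I. ?u x * ?u x)" by (simp add: spec_energy_def)
  also have "\<dots> \<le> (\<Sum>x\<in>Pow I. ?u x * ((1 + cmod ?E) / 2))"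
    by (intro sum_mono mult_left_mono bd) auto
  also have "\<dots> = (\<Sum>x\<in>Pow I. ?u x) * ((1 + cmod ?E) / 2)"
    by (rule sum_distrib_right[symmetric])
  also have "\<dots> = (1 + cmod ?E) / 2"
    by (simp only: unimod_hat_L2[OF assms] mult_1)
  finally show ?thesis .
qed

text \<open>
  Expanding the large part of \<open>g\<close> into Walsh functions, the diagonal terms give the product of the
  autocorrelations and the off-diagonal terms only involve differences in the spectrum of \<open>f\<close>.
\<close>

lemma product_energy:
  fixes \<kappa> :: real
  assumes I: "finite I" and g: "unimod I g" and f: "unimod I f"
    and \<kappa>: "0 \<le> \<kappa>" "\<kappa> \<le> 1" and \<Lambda>: "\<Lambda> \<subseteq> Pow I"
    and tail: "(\<Sum>x\<in>Pow I - \<Lambda>. (cmod (hat I g x))\<^sup>2) \<le> \<kappa>\<^sup>2"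
  shows "spec_energy I (\<lambda>J. g J * f J) {} \<le>
      (\<Sum>a\<in>Pow I. (cmod (auto_corr I g a))\<^sup>2 * (cmod (auto_corr I f a))\<^sup>2) / 2 ^ card I +
      8 * \<kappa> + 2 * (\<Sum>\<alpha>\<in>\<Lambda>. \<Sum>\<beta>\<in>\<Lambda> - {\<alpha>}. sqrt (spec_energy I f (\<alpha> \<oplus> \<beta>)))"
proof -
  let ?N = "2 ^ card I :: real" and ?c = "hat I g"
  let ?gf = "\<lambda>J. g J * f J"
  let ?A = "auto_corr I"
  \<comment> \<open>Split \<open>g\<close> along \<Lambda> into a main part \<open>u\<close> and a
    remainder \<open>r\<close> that is small in mean square.\<close>
  define u where "u J = (\<Sum>x\<in>\<Lambda>. ?c x * wal x J)" for J
  define r where "r J = (\<Sum>x\<in>Pow I - \<Lambda>. ?c x * wal x J)" for J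
  have N_pos: "?N > 0" by simp
  have norm_bound: "cmod (- x * y + z) \<le> cmod x * cmod y + cmod z" for x y z :: complex
    using norm_triangle_ineq[of "- x * y" z] by (simp add: norm_mult)
  have fin: "finite (Pow I)" "finite \<Lambda>" using I \<Lambda> finite_subset by auto
  have finI: "finite K" if "K \<subseteq> I" for K using that I finite_subset by blast
  have g_eq: "g J = u J + r J" if "J \<subseteq> I" for J
    using hat_inversion[OF I that, of g] sum.subset_diff[OF \<Lambda> fin(1), of "\<lambda>x. ?c x * wal x J"]
    by (simp add: u_def r_def add.commute)
  have gf: "unimod I ?gf" using f g by (simp add: unimod_def norm_mult)
  have "(\<Sum>J\<in>Pow I. (cmod (r J))\<^sup>2) / ?N = (\<Sum>x\<in>Pow I. (cmod (if x \<in> \<Lambda> then 0 else ?c x))\<^sup>2)"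
  proof (rule plancherel_synthesis[OF I])
    fix a show "r a = (\<Sum>x\<in>Pow I. (if x \<in> \<Lambda> then 0 else ?c x) * wal x a)"
      unfolding r_def by (rule sum.mono_neutral_cong_left) (use fin in auto)
  qed
  also have "\<dots> = (\<Sum>x\<in>Pow I - \<Lambda>. (cmod (?c x))\<^sup>2)"
    by (rule sum.mono_neutral_cong_right) (use fin in auto)
  finally have r2: "(\<Sum>J\<in>Pow I. (cmod (r J))\<^sup>2) / ?N \<le> \<kappa>\<^sup>2" using tail by simp
  have r1: "(\<Sum>J\<in>Pow I. cmod (r J)) / ?N \<le> \<kappa>"
  proof -
    have "(\<Sum>J\<in>Pow I. cmod (r J)) / ?N \<le> sqrt ((\<Sum>J\<in>Pow I. (cmod (r J))\<^sup>2) / ?N)"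
      using sum_Pow_abs_le[OF I, of "\<lambda>J. cmod (r J)"] by simp
    also have "\<dots> \<le> sqrt (\<kappa>\<^sup>2)" using r2 by (rule real_sqrt_le_mono)
    finally show ?thesis using \<kappa> by simp
  qed
  \<comment> \<open>The autocorrelation of the product with \<open>g\<close> replaced by
    \<open>u\<close>, which need not be unimodular.\<close>
  define X where "X a = (\<Sum>h\<in>Pow I. u h * cnj (u (h \<oplus> a)) * (f h * cnj (f (h \<oplus> a)))) / ?N" for a
  have step1: "cmod (?A ?gf a - X a) \<le> 2 * \<kappa> + \<kappa>\<^sup>2" if a: "a \<subseteq> I" for a
  proof -
    \<comment> \<open>The factors are replaced one at a time. As |u| \<le> 1 + |r|, a single
      quadratic term arises; by 2xy \<le> x^2 + y^2 it averages to at most \<kappa>^2.\<close>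
    have *: "cmod (g h * cnj (g (h \<oplus> a)) - u h * cnj (u (h \<oplus> a)))
        \<le> cmod (r h) + (cmod (r (h \<oplus> a)) + ((cmod (r h))\<^sup>2 + (cmod (r (h \<oplus> a)))\<^sup>2) / 2)"
      if h: "h \<subseteq> I" for h
    proof -
      have ha: "h \<oplus> a \<subseteq> I" using h a by (rule sd_subset)
      have "g h * cnj (g (h \<oplus> a)) - u h * cnj (u (h \<oplus> a))
          = r h * cnj (g (h \<oplus> a)) + u h * cnj (r (h \<oplus> a))"
        using g_eq[OF h] g_eq[OF ha] by (simp add: algebra_simps)
      also have "cmod \<dots> \<le> cmod (r h) * 1 + cmod (u h) * cmod (r (h \<oplus> a))"
        by (rule order_trans[OF norm_triangle_ineq]) (use g ha in \<open>simp add: norm_mult unimod_def\<close>)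
      also have "cmod (u h) \<le> 1 + cmod (r h)"
      proof -
        have "u h = g h - r h" using g_eq[OF h] by simp
        thus ?thesis using norm_triangle_ineq4[of "g h" "r h"] g h by (simp add: unimod_def)
      qed
      finally have "cmod (g h * cnj (g (h \<oplus> a)) - u h * cnj (u (h \<oplus> a)))
          \<le> cmod (r h) + (1 + cmod (r h)) * cmod (r (h \<oplus> a))" by (simp add: mult_right_mono)
      also have "\<dots> \<le> cmod (r h) + (cmod (r (h \<oplus> a)) + ((cmod (r h))\<^sup>2 + (cmod (r (h \<oplus> a)))\<^sup>2) / 2)"
        using sum_squares_bound[of "cmod (r h)" "cmod (r (h \<oplus> a))"] by (simp add: algebra_simps)
      finally show ?thesis .
    qed
    have "?A ?gf a - X a = (\<Sum>h\<in>Pow I. (g h * cnj (g (h \<oplus> a)) - u h * cnj (u (h \<oplus> a)))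
        * (f h * cnj (f (h \<oplus> a)))) / ?N"
      unfolding auto_corr_def X_def by (simp add: diff_divide_distrib sum_subtractf algebra_simps)
    also have "cmod \<dots> \<le> (\<Sum>h\<in>Pow I. cmod (r h) + (cmod (r (h \<oplus> a))
        + ((cmod (r h))\<^sup>2 + (cmod (r (h \<oplus> a)))\<^sup>2) / 2)) / ?N"
      unfolding norm_divide norm_of_real abs_of_pos[OF N_pos]
    proof (intro divide_right_mono sum_norm_le)
      fix h assume "h \<in> Pow I"
      thus "cmod ((g h * cnj (g (h \<oplus> a)) - u h * cnj (u (h \<oplus> a))) * (f h * cnj (f (h \<oplus> a))))
        \<le> cmod (r h) + (cmod (r (h \<oplus> a)) + ((cmod (r h))\<^sup>2 + (cmod (r (h \<oplus> a)))\<^sup>2) / 2)"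
        using * f sd_subset[of h I a] a unfolding norm_mult by (simp add: unimod_def)
    qed simp
    also have "\<dots> = 2 * ((\<Sum>J\<in>Pow I. cmod (r J)) / ?N) + (\<Sum>J\<in>Pow I. (cmod (r J))\<^sup>2) / ?N"
      using sum_Pow_sd[OF a, of "\<lambda>J. cmod (r J)"] sum_Pow_sd[OF a, of "\<lambda>J. (cmod (r J))\<^sup>2"]
      by (simp add: sum.distrib add_divide_distrib flip: sum_divide_distrib)
    finally show ?thesis using r1 r2 by linarith
  qed
  \<comment> \<open>Pairs \<alpha> = \<beta> rebuild the autocorrelation of \<open>g\<close> up to
    the tail of mass \<kappa>^2; all other pairs are twisted correlations of
    \<open>f\<close>.\<close>
  have step2: "cmod (X a - ?A g a * ?A f a)
      \<le> \<kappa>\<^sup>2 + (\<Sum>\<alpha>\<in>\<Lambda>. \<Sum>\<beta>\<in>\<Lambda> - {\<alpha>}. cmod (twist_corr I f (\<alpha> \<oplus> \<beta>) a))" if a: "a \<subseteq> I" for a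
  proof -
    let ?t = "\<lambda>\<alpha> \<beta>. ?c \<alpha> * cnj (?c \<beta>) * wal \<beta> a * twist_corr I f (\<alpha> \<oplus> \<beta>) a"
    have "(\<Sum>h\<in>Pow I. u h * cnj (u (h \<oplus> a)) * (f h * cnj (f (h \<oplus> a))))
        = (\<Sum>h\<in>Pow I. \<Sum>\<alpha>\<in>\<Lambda>. \<Sum>\<beta>\<in>\<Lambda>. ?c \<alpha> * cnj (?c \<beta>) * wal \<beta> a *
             (f h * cnj (f (h \<oplus> a)) * wal (\<alpha> \<oplus> \<beta>) h))"
    proof (rule sum.cong)
      fix h assume h: "h \<in> Pow I"
      have "u (h \<oplus> a) = (\<Sum>x\<in>\<Lambda>. ?c x * (wal x h * wal x a))"
        unfolding u_def by (intro sum.cong) (use \<Lambda> finI h a in \<open>auto simp: wal_sd_right subset_iff\<close>)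
      hence uu: "u h * cnj (u (h \<oplus> a))
          = (\<Sum>\<alpha>\<in>\<Lambda>. \<Sum>\<beta>\<in>\<Lambda>. (?c \<alpha> * wal \<alpha> h) * cnj (?c \<beta> * (wal \<beta> h * wal \<beta> a)))"
        by (simp only: u_def[of h] sum_product cnj_sum)
      show "u h * cnj (u (h \<oplus> a)) * (f h * cnj (f (h \<oplus> a))) = (\<Sum>\<alpha>\<in>\<Lambda>. \<Sum>\<beta>\<in>\<Lambda>. ?c \<alpha> * cnj (?c \<beta>) * wal \<beta> a *
             (f h * cnj (f (h \<oplus> a)) * wal (\<alpha> \<oplus> \<beta>) h))"
        unfolding uu sum_distrib_right by (simp add: wal_sd_left mult_ac)
    qed simp
    also have "\<dots> = (\<Sum>\<alpha>\<in>\<Lambda>. \<Sum>h\<in>Pow I. \<Sum>\<beta>\<in>\<Lambda>. ?c \<alpha> * cnj (?c \<beta>) * wal \<beta> a *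
             (f h * cnj (f (h \<oplus> a)) * wal (\<alpha> \<oplus> \<beta>) h))"
      by (rule sum.swap)
    also have "\<dots> = (\<Sum>\<alpha>\<in>\<Lambda>. \<Sum>\<beta>\<in>\<Lambda>. \<Sum>h\<in>Pow I. ?c \<alpha> * cnj (?c \<beta>) * wal \<beta> a *
             (f h * cnj (f (h \<oplus> a)) * wal (\<alpha> \<oplus> \<beta>) h))"
      by (intro sum.cong sum.swap refl)
    also have "\<dots> = (\<Sum>\<alpha>\<in>\<Lambda>. \<Sum>\<beta>\<in>\<Lambda>. ?t \<alpha> \<beta> * ?N)"
      by (simp add: twist_corr_def sum_distrib_left)
    finally have X: "X a = (\<Sum>\<alpha>\<in>\<Lambda>. \<Sum>\<beta>\<in>\<Lambda>. ?t \<alpha> \<beta>)"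
      by (simp add: X_def flip: sum_distrib_right)
    have tt: "twist_corr I f {} a = ?A f a" by (simp add: twist_corr_def auto_corr_def)
    have "(\<Sum>\<alpha>\<in>\<Lambda>. \<Sum>\<beta>\<in>\<Lambda>. ?t \<alpha> \<beta>) = (\<Sum>\<alpha>\<in>\<Lambda>. ?t \<alpha> \<alpha> + (\<Sum>\<beta>\<in>\<Lambda> - {\<alpha>}. ?t \<alpha> \<beta>))"
      by (intro sum.cong sum.remove fin refl)
    hence X2: "X a = (\<Sum>\<alpha>\<in>\<Lambda>. ?c \<alpha> * cnj (?c \<alpha>) * wal \<alpha> a) * ?A f a + (\<Sum>\<alpha>\<in>\<Lambda>. \<Sum>\<beta>\<in>\<Lambda> - {\<alpha>}. ?t \<alpha> \<beta>)"
      unfolding X by (simp add: tt sum.distrib sum_distrib_right)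
    have "?A g a = (\<Sum>\<alpha>\<in>Pow I - \<Lambda>. ?c \<alpha> * cnj (?c \<alpha>) * wal \<alpha> a) + (\<Sum>\<alpha>\<in>\<Lambda>. ?c \<alpha> * cnj (?c \<alpha>) * wal \<alpha> a)"
      unfolding auto_corr_eq[OF I a] complex_norm_square by (rule sum.subset_diff[OF \<Lambda> fin(1)])
    hence eq: "X a - ?A g a * ?A f a = - (\<Sum>\<alpha>\<in>Pow I - \<Lambda>. ?c \<alpha> * cnj (?c \<alpha>) * wal \<alpha> a) * ?A f a
         + (\<Sum>\<alpha>\<in>\<Lambda>. \<Sum>\<beta>\<in>\<Lambda> - {\<alpha>}. ?t \<alpha> \<beta>)"
      unfolding X2 by (simp add: algebra_simps)
    have "cmod (X a - ?A g a * ?A f a) \<le> cmod (\<Sum>\<alpha>\<in>Pow I - \<Lambda>. ?c \<alpha> * cnj (?c \<alpha>) * wal \<alpha> a) * cmod (?A f a)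
         + cmod (\<Sum>\<alpha>\<in>\<Lambda>. \<Sum>\<beta>\<in>\<Lambda> - {\<alpha>}. ?t \<alpha> \<beta>)"
      unfolding eq by (rule norm_bound)
    moreover have "cmod (\<Sum>\<alpha>\<in>Pow I - \<Lambda>. ?c \<alpha> * cnj (?c \<alpha>) * wal \<alpha> a) * cmod (?A f a) \<le> \<kappa>\<^sup>2 * 1"
    proof (rule mult_mono)
      have "cmod (\<Sum>\<alpha>\<in>Pow I - \<Lambda>. ?c \<alpha> * cnj (?c \<alpha>) * wal \<alpha> a) \<le> (\<Sum>\<alpha>\<in>Pow I - \<Lambda>. (cmod (?c \<alpha>))\<^sup>2)"
        by (rule sum_norm_le) (simp add: norm_mult power2_eq_square)
      thus "cmod (\<Sum>\<alpha>\<in>Pow I - \<Lambda>. ?c \<alpha> * cnj (?c \<alpha>) * wal \<alpha> a) \<le> \<kappa>\<^sup>2"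
        using tail by (rule order_trans)
      show "cmod (?A f a) \<le> 1" by (rule unimod_autocorr_le_1[OF I f a])
    qed simp_all
    moreover have "cmod (\<Sum>\<alpha>\<in>\<Lambda>. \<Sum>\<beta>\<in>\<Lambda> - {\<alpha>}. ?t \<alpha> \<beta>) \<le> (\<Sum>\<alpha>\<in>\<Lambda>. \<Sum>\<beta>\<in>\<Lambda> - {\<alpha>}. cmod (twist_corr I f (\<alpha> \<oplus> \<beta>) a))"
    proof (rule sum_norm_le, rule sum_norm_le)
      fix \<alpha> \<beta> assume "\<alpha> \<in> \<Lambda>" "\<beta> \<in> \<Lambda> - {\<alpha>}"
      hence "cmod (?c \<alpha>) \<le> 1" "cmod (?c \<beta>) \<le> 1" using \<Lambda> by (auto intro!: unimod_hat_le_1 I g)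
      hence "cmod (?c \<alpha>) * cmod (?c \<beta>) \<le> 1" by (intro mult_le_one) simp_all
      hence "cmod (?c \<alpha>) * cmod (?c \<beta>) * cmod (twist_corr I f (\<alpha> \<oplus> \<beta>) a) \<le> 1 * cmod (twist_corr I f (\<alpha> \<oplus> \<beta>) a)"
        by (rule mult_right_mono) simp
      thus "cmod (?t \<alpha> \<beta>) \<le> cmod (twist_corr I f (\<alpha> \<oplus> \<beta>) a)" by (simp add: norm_mult)
    qed
    ultimately show ?thesis by simp
  qed
  \<comment> \<open>The errors 2\<kappa> + \<kappa>^2 and \<kappa>^2 are together at most 4\<kappa>.
    Passing to squares doubles them, since both moduli are at most 1.\<close>
  have pointwise: "(cmod (?A ?gf a))\<^sup>2 \<le> (cmod (?A g a))\<^sup>2 * (cmod (?A f a))\<^sup>2 +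
      (8 * \<kappa> + 2 * (\<Sum>\<alpha>\<in>\<Lambda>. \<Sum>\<beta>\<in>\<Lambda> - {\<alpha>}. cmod (twist_corr I f (\<alpha> \<oplus> \<beta>) a)))" if a: "a \<subseteq> I" for a
  proof -
    let ?x = "cmod (?A ?gf a)" and ?y = "cmod (?A g a * ?A f a)"
    let ?s = "\<Sum>\<alpha>\<in>\<Lambda>. \<Sum>\<beta>\<in>\<Lambda> - {\<alpha>}. cmod (twist_corr I f (\<alpha> \<oplus> \<beta>) a)"
    have x: "?x \<le> 1" by (rule unimod_autocorr_le_1[OF I gf a])
    have y: "?y \<le> 1" unfolding norm_mult
      using unimod_autocorr_le_1[OF I f a] unimod_autocorr_le_1[OF I g a] by (intro mult_le_one) auto
    have k2: "\<kappa>\<^sup>2 \<le> \<kappa>" using \<kappa> by (simp add: power2_eq_square mult_left_le)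
    have "?x - ?y \<le> cmod (?A ?gf a - ?A g a * ?A f a)" by (rule norm_triangle_ineq2)
    also have "\<dots> \<le> cmod (?A ?gf a - X a) + cmod (X a - ?A g a * ?A f a)"
      using norm_triangle_ineq[of "?A ?gf a - X a" "X a - ?A g a * ?A f a"] by simp
    also have "\<dots> \<le> 4 * \<kappa> + ?s" using step1[OF a] step2[OF a] k2 by linarith
    finally have d: "?x - ?y \<le> 4 * \<kappa> + ?s" .
    have s: "0 \<le> 4 * \<kappa> + ?s" using \<kappa> by (intro add_nonneg_nonneg sum_nonneg) auto
    have "?x\<^sup>2 - ?y\<^sup>2 = (?x - ?y) * (?x + ?y)" by (simp add: power2_eq_square algebra_simps)
    also have "\<dots> \<le> (4 * \<kappa> + ?s) * (?x + ?y)" by (intro mult_right_mono d) auto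
    also have "\<dots> \<le> (4 * \<kappa> + ?s) * 2" using x y s by (intro mult_left_mono) auto
    finally show ?thesis by (simp add: norm_mult power_mult_distrib)
  qed
  have "spec_energy I ?gf {} = (\<Sum>a\<in>Pow I. (cmod (?A ?gf a))\<^sup>2) / ?N"
    by (rule auto_corr_L2[OF I, symmetric])
  also have "\<dots> \<le> (\<Sum>a\<in>Pow I. (cmod (?A g a))\<^sup>2 * (cmod (?A f a))\<^sup>2 +
      (8 * \<kappa> + 2 * (\<Sum>\<alpha>\<in>\<Lambda>. \<Sum>\<beta>\<in>\<Lambda> - {\<alpha>}. cmod (twist_corr I f (\<alpha> \<oplus> \<beta>) a)))) / ?N"
    by (intro divide_right_mono sum_mono pointwise) auto
  also have "\<dots> = (\<Sum>a\<in>Pow I. (cmod (?A g a))\<^sup>2 * (cmod (?A f a))\<^sup>2) / ?N + 8 * \<kappa>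
     + 2 * ((\<Sum>a\<in>Pow I. \<Sum>\<alpha>\<in>\<Lambda>. \<Sum>\<beta>\<in>\<Lambda> - {\<alpha>}. cmod (twist_corr I f (\<alpha> \<oplus> \<beta>) a)) / ?N)"
    using I by (simp add: sum.distrib add_divide_distrib card_Pow flip: sum_distrib_left)
  also have "(\<Sum>a\<in>Pow I. \<Sum>\<alpha>\<in>\<Lambda>. \<Sum>\<beta>\<in>\<Lambda> - {\<alpha>}. cmod (twist_corr I f (\<alpha> \<oplus> \<beta>) a))
     = (\<Sum>\<alpha>\<in>\<Lambda>. \<Sum>a\<in>Pow I. \<Sum>\<beta>\<in>\<Lambda> - {\<alpha>}. cmod (twist_corr I f (\<alpha> \<oplus> \<beta>) a))"
    by (rule sum.swap)
  also have "\<dots> = (\<Sum>\<alpha>\<in>\<Lambda>. \<Sum>\<beta>\<in>\<Lambda> - {\<alpha>}. \<Sum>a\<in>Pow I. cmod (twist_corr I f (\<alpha> \<oplus> \<beta>) a))"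
    by (intro sum.cong sum.swap refl)
  also have "\<dots> / ?N = (\<Sum>\<alpha>\<in>\<Lambda>. \<Sum>\<beta>\<in>\<Lambda> - {\<alpha>}. (\<Sum>a\<in>Pow I. cmod (twist_corr I f (\<alpha> \<oplus> \<beta>) a)) / ?N)"
    by (simp add: sum_divide_distrib)
  \<comment> \<open>Cauchy-Schwarz in \<open>a\<close> turns the mean modulus of each twist into the
    square root of an energy.\<close>
  also have "\<dots> \<le> (\<Sum>\<alpha>\<in>\<Lambda>. \<Sum>\<beta>\<in>\<Lambda> - {\<alpha>}. sqrt (spec_energy I f (\<alpha> \<oplus> \<beta>)))"
    using sum_Pow_abs_le[OF I, of "\<lambda>a. cmod (twist_corr I f d a)" for d] twist_corr_L2[OF I, of f]
    by (intro sum_mono) simp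
  finally show ?thesis by simp
qed

section \<open>The mean energy of the rotations\<close>


definition rot :: "nat \<Rightarrow> ('a set \<Rightarrow> int) \<Rightarrow> nat \<Rightarrow> 'a set \<Rightarrow> complex" where
  "rot L F k J = cis (2 * pi * real k * of_int (F J) / real L)"

lemma unimod_rot: "unimod I (rot L F k)"
  by (simp add: unimod_def rot_def)

lemma rot_add: "rot L F (k + l) J = rot L F k J * rot L F l J"
  by (simp add: rot_def cis_mult algebra_simps add_divide_distrib)

lemma rot_mod:
  assumes "L > 0"
  shows "rot L F (k mod L) = rot L F k"
proof
  fix J
  have "cis (2 * pi * real (L * (k div L)) * of_int (F J) / real L) = cis (2 * pi * of_int (int (k div L) * F J))"
    using assms by (simp add: field_simps)
  also have "\<dots> = 1" by (rule cis_multiple_2pi) auto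
  finally have "rot L F (L * (k div L)) J = 1" by (simp add: rot_def)
  thus "rot L F (k mod L) J = rot L F k J"
    using rot_add[of L F "L * (k div L)" "k mod L" J] by simp
qed

text \<open>As \<open>F\<close> is integer-valued, \<open>rot\<close> depends only on
  \<open>k\<close> modulo \<open>L\<close>, and adding \<open>k\<close> permutes the
  residues.\<close>

lemma sum_rot_shift:
  assumes "L > 0"
  shows "(\<Sum>l<L. \<phi> (rot L F (k + l))) = (\<Sum>l<L. \<phi> (rot L F l))"
proof -
  have inj: "inj_on (\<lambda>l. (k + l) mod L) {..<L}"
  proof (rule inj_onI)
    fix x y assume xy: "x \<in> {..<L}" "y \<in> {..<L}" "(k + x) mod L = (k + y) mod L"
    hence "L dvd k + x - (k + y)" "L dvd k + y - (k + x)"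
      by (metis mod_eq_dvd_iff_nat nat_le_linear diff_is_0_eq' dvd_0_right)+
    thus "x = y" using xy by (auto dest!: dvd_imp_le)
  qed
  have "(\<Sum>l<L. \<phi> (rot L F (k + l))) = (\<Sum>l\<in>(\<lambda>l. (k + l) mod L) ` {..<L}. \<phi> (rot L F l))"
    by (simp add: sum.reindex[OF inj] rot_mod[OF assms])
  also have "(\<lambda>l. (k + l) mod L) ` {..<L} = {..<L}"
    by (rule card_subset_eq) (use assms inj in \<open>auto simp: card_image\<close>)
  finally show ?thesis .
qed

lemma sum_cis_eq_0:
  assumes "L > 0" "\<not> int L dvd m"
  shows "(\<Sum>k<L. cis (2 * pi * real k * of_int m / real L)) = 0"
proof -
  define z where "z = cis (2 * pi * of_int m / real L)"
  have pow: "cis (2 * pi * real k * of_int m / real L) = z ^ k" for k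
    by (simp add: z_def Complex.DeMoivre mult_ac)
  have "z ^ L = cis (2 * pi * of_int m)"
    unfolding pow[symmetric] using assms(1) by (intro arg_cong[where f = cis]) simp
  also have "\<dots> = 1" by (rule cis_multiple_2pi) simp
  finally have zL: "z ^ L = 1" .
  have "z \<noteq> 1"
  proof
    assume "z = 1"
    hence "cos (2 * pi * of_int m / real L) = 1" by (metis cis.sel(1) one_complex.sel(1) z_def)
    then obtain n :: int where n: "2 * pi * of_int m / real L = of_int n * 2 * pi"
      by (auto simp: cos_one_2pi_int)
    hence "real_of_int m = of_int (n * int L)" using assms(1) by (simp add: field_simps)
    hence "m = n * int L" by (simp only: of_int_eq_iff)
    thus False using assms(2) by simp
  qed
  thus ?thesis unfolding pow using geometric_sum[of z L] zL by simp
qed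

section \<open>The mean energy over all rotations\<close>

definition mean_energy :: "nat \<Rightarrow> 'a set \<Rightarrow> ('a set \<Rightarrow> int) \<Rightarrow> 'a set \<Rightarrow> real" where
  "mean_energy L I F d = (\<Sum>k<L. spec_energy I (rot L F k) d) / L"

lemma mean_energy_nonneg: "mean_energy L I F d \<ge> 0"
  by (simp add: mean_energy_def sum_nonneg spec_energy_nonneg)

lemma sum_mean_energy:
  assumes "finite I" "L > 0"
  shows "(\<Sum>d\<in>Pow I. mean_energy L I F d) = 1"
proof -
  have "(\<Sum>d\<in>Pow I. mean_energy L I F d) = (\<Sum>k<L. \<Sum>d\<in>Pow I. spec_energy I (rot L F k) d) / L"
    unfolding mean_energy_def by (simp add: sum.swap[of _ _ "Pow I"] flip: sum_divide_distrib)
  thus ?thesis using assms sum_spec_energy[OF assms(1) unimod_rot] by simp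
qed

lemma mean_energy_le_1:
  assumes "finite I" "L > 0" "d \<subseteq> I"
  shows "mean_energy L I F d \<le> 1"
  using member_le_sum[of d "Pow I" "mean_energy L I F"] sum_mean_energy[OF assms(1,2), of F] assms
  by (auto simp: mean_energy_nonneg)

text \<open>The factor 2 makes the squares of the rotations orthogonal as functions of
  \<open>k\<close>: they oscillate with frequencies \<open>2 * F J\<close> modulo
  \<open>L\<close>.\<close>

definition separated :: "nat \<Rightarrow> 'a set \<Rightarrow> ('a set \<Rightarrow> int) \<Rightarrow> bool" where
  "separated L I F \<longleftrightarrow> (\<forall>J\<subseteq>I. \<forall>K\<subseteq>I. J \<noteq> K \<longrightarrow> \<not> int L dvd 2 * (F J - F K))"

lemma mean_abs_le:
  assumes "L > 0"
  shows "(\<Sum>k<L. \<bar>f k\<bar>) / real L \<le> sqrt ((\<Sum>k<L. (f k)\<^sup>2) / real L)"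
proof (rule real_le_rsqrt)
  have "(\<Sum>k<L. \<bar>f k\<bar> * 1)\<^sup>2 \<le> (\<Sum>k<L. \<bar>f k\<bar>\<^sup>2) * (\<Sum>k<L. 1\<^sup>2)"
    by (rule Cauchy_Schwarz_ineq_sum)
  thus "((\<Sum>k<L. \<bar>f k\<bar>) / real L)\<^sup>2 \<le> (\<Sum>k<L. (f k)\<^sup>2) / real L"
    using assms by (simp add: power_divide field_simps power2_eq_square)
qed

text \<open>\<open>e k\<close> is the mean of the squared rotation over the cube. By orthogonality
  in \<open>k\<close>, |e|^2 has mean \<open>1 / ?N\<close>, which is at most 1/4 from dimension 2
  on. So |e| has mean at most 1/2, and (1 + 1/2) / 2 = 3/4.\<close>

lemma mean_energy_le_three_quarters:
  assumes I: "finite I" "card I \<ge> 2" and L: "L > 0" and sep: "separated L I F"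
  shows "mean_energy L I F {} \<le> 3 / 4"
proof -
  let ?N = "2 ^ card I :: real"
  define e where "e k = (\<Sum>J\<in>Pow I. (rot L F k J)\<^sup>2) / ?N" for k
  have N: "?N \<ge> 4" using power_increasing[OF I(2), of "2::real"] by simp
  have e2: "complex_of_real ((cmod (e k))\<^sup>2) = (\<Sum>J\<in>Pow I. \<Sum>K\<in>Pow I.
      cis (2 * pi * real k * of_int (2 * (F J - F K)) / real L)) / ?N\<^sup>2" for k
  proof -
    have *: "(rot L F k J)\<^sup>2 * cnj ((rot L F k K)\<^sup>2) = cis (2 * pi * real k * of_int (2 * (F J - F K)) / real L)" for J K
      unfolding rot_def Complex.DeMoivre cis_cnj cis_mult
      by (rule arg_cong[where f = cis]) (simp add: diff_divide_distrib algebra_simps)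
    have "complex_of_real ((cmod (e k))\<^sup>2) = (\<Sum>J\<in>Pow I. \<Sum>K\<in>Pow I. (rot L F k J)\<^sup>2 * cnj ((rot L F k K)\<^sup>2)) / ?N\<^sup>2"
      unfolding complex_norm_square e_def by (simp add: sum_product power2_eq_square)
    thus ?thesis unfolding * .
  qed
  have "complex_of_real (\<Sum>k<L. (cmod (e k))\<^sup>2) = (\<Sum>k<L. \<Sum>J\<in>Pow I. \<Sum>K\<in>Pow I.
      cis (2 * pi * real k * of_int (2 * (F J - F K)) / real L)) / ?N\<^sup>2"
    unfolding of_real_sum e2 by (simp flip: sum_divide_distrib)
  also have "(\<Sum>k<L. \<Sum>J\<in>Pow I. \<Sum>K\<in>Pow I. cis (2 * pi * real k * of_int (2 * (F J - F K)) / real L))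
    = (\<Sum>J\<in>Pow I. \<Sum>k<L. \<Sum>K\<in>Pow I. cis (2 * pi * real k * of_int (2 * (F J - F K)) / real L))"
    by (rule sum.swap)
  also have "\<dots> = (\<Sum>J\<in>Pow I. \<Sum>K\<in>Pow I. \<Sum>k<L. cis (2 * pi * real k * of_int (2 * (F J - F K)) / real L))"
    by (intro sum.cong sum.swap refl)
  also have "\<dots> = (\<Sum>J\<in>Pow I. \<Sum>K\<in>Pow I. if K = J then of_nat L else 0)"
  proof (intro sum.cong refl)
    fix J K assume "J \<in> Pow I" "K \<in> Pow I"
    hence "\<not> int L dvd 2 * (F J - F K)" if "K \<noteq> J" using sep that by (auto simp: separated_def)
    thus "(\<Sum>k<L. cis (2 * pi * real k * of_int (2 * (F J - F K)) / real L)) = (if K = J then of_nat L else 0)"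
      using sum_cis_eq_0[OF L, of "2 * (F J - F K)"] by auto
  qed
  also have "\<dots> = complex_of_real (?N * real L)"
    using I by (simp add: sum.delta card_Pow)
  also have "\<dots> / ?N\<^sup>2 = complex_of_real (real L / ?N)" by (simp add: power2_eq_square)
  finally have "(\<Sum>k<L. (cmod (e k))\<^sup>2) = real L / ?N" by (simp only: of_real_eq_iff)
  hence "(\<Sum>k<L. \<bar>cmod (e k)\<bar>) / real L \<le> sqrt (1 / ?N)"
    using mean_abs_le[OF L, of "\<lambda>k. cmod (e k)"] L by simp
  also have "\<dots> \<le> sqrt (1 / 4)" using N by (intro real_sqrt_le_mono divide_left_mono) auto
  finally have e1: "(\<Sum>k<L. cmod (e k)) / real L \<le> 1 / 2" by (simp add: real_sqrt_divide)
  have "mean_energy L I F {} \<le> (\<Sum>k<L. (1 + cmod (e k)) / 2) / L"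
    unfolding mean_energy_def
    using spec_energy_le_sum_hat_sq[OF I(1) unimod_rot, of L F]
    by (intro divide_right_mono sum_mono) (simp_all add: e_def sum_hat_sq[OF I(1)])
  also have "\<dots> = (1 + (\<Sum>k<L. cmod (e k)) / L) / 2"
    using L by (simp add: sum.distrib add_divide_distrib flip: sum_divide_distrib)
  finally show ?thesis using e1 by argo
qed

text \<open>At each \<open>a\<close> the double mean over \<open>k\<close> and \<open>l\<close>
  factors into the square of \<open>q a\<close>, and the Walsh coefficients of \<open>q\<close> are
  the mean energies; Plancherel concludes.\<close>

lemma sum_mean_energy_sq:
  assumes I: "finite I" and L: "L > 0"
  shows "(\<Sum>k<L. \<Sum>l<L. (\<Sum>a\<in>Pow I. (cmod (auto_corr I (rot L F k) a))\<^sup>2 *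
      (cmod (auto_corr I (rot L F l) a))\<^sup>2) / 2 ^ card I) / (real L)\<^sup>2 = (\<Sum>d\<in>Pow I. (mean_energy L I F d)\<^sup>2)"
proof -
  let ?N = "2 ^ card I :: real"
  define q where "q a = (\<Sum>k<L. (cmod (auto_corr I (rot L F k) a))\<^sup>2) / L" for a
  have q: "q a = (\<Sum>d\<in>Pow I. mean_energy L I F d * wal d a)" if "a \<subseteq> I" for a
  proof -
    have "q a = (\<Sum>d\<in>Pow I. \<Sum>k<L. spec_energy I (rot L F k) d * wal d a) / L"
      unfolding q_def auto_corr_norm_sq[OF I that] by (subst sum.swap) simp
    thus ?thesis by (simp add: mean_energy_def sum_divide_distrib sum_distrib_right)
  qed
  have "(\<Sum>k<L. \<Sum>l<L. (\<Sum>a\<in>Pow I. (cmod (auto_corr I (rot L F k) a))\<^sup>2 *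
      (cmod (auto_corr I (rot L F l) a))\<^sup>2) / ?N)
    = (\<Sum>k<L. \<Sum>l<L. \<Sum>a\<in>Pow I. (cmod (auto_corr I (rot L F k) a))\<^sup>2 *
      (cmod (auto_corr I (rot L F l) a))\<^sup>2) / ?N"
    by (simp add: sum_divide_distrib)
  also have "(\<Sum>k<L. \<Sum>l<L. \<Sum>a\<in>Pow I. (cmod (auto_corr I (rot L F k) a))\<^sup>2 *
      (cmod (auto_corr I (rot L F l) a))\<^sup>2)
    = (\<Sum>k<L. \<Sum>a\<in>Pow I. \<Sum>l<L. (cmod (auto_corr I (rot L F k) a))\<^sup>2 *
      (cmod (auto_corr I (rot L F l) a))\<^sup>2)"
    by (intro sum.cong sum.swap refl)
  also have "\<dots> = (\<Sum>a\<in>Pow I. \<Sum>k<L. \<Sum>l<L. (cmod (auto_corr I (rot L F k) a))\<^sup>2 *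
      (cmod (auto_corr I (rot L F l) a))\<^sup>2)"
    by (rule sum.swap)
  also have "\<dots> = (\<Sum>a\<in>Pow I. (q a * L)\<^sup>2)"
    using L by (simp add: q_def power2_eq_square sum_product)
  also have "\<dots> = (\<Sum>a\<in>Pow I. (q a)\<^sup>2) * (real L)\<^sup>2"
    by (simp add: power_mult_distrib sum_distrib_right)
  finally have "(\<Sum>k<L. \<Sum>l<L. (\<Sum>a\<in>Pow I. (cmod (auto_corr I (rot L F k) a))\<^sup>2 *
      (cmod (auto_corr I (rot L F l) a))\<^sup>2) / ?N) / (real L)\<^sup>2 = (\<Sum>a\<in>Pow I. (q a)\<^sup>2) / ?N"
    using L by simp
  also have "\<dots> = (\<Sum>a\<in>Pow I. (cmod (complex_of_real (q a)))\<^sup>2) / ?N" by simp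
  also have "\<dots> = (\<Sum>d\<in>Pow I. (cmod (complex_of_real (mean_energy L I F d)))\<^sup>2)"
    by (rule plancherel_synthesis[OF I]) (simp add: q)
  finally show ?thesis by simp
qed

text \<open>By shift invariance the mean energy is also the mean over products of two rotations,
  where \<open>product_energy\<close> applies. Its main terms average to the sum of the squared mean
  energies, to which every \<open>d \<noteq> {}\<close> contributes little.\<close>

lemma mean_energy_almost_idempotent:
  fixes \<kappa> \<theta> \<epsilon> :: real
  assumes I: "finite I" and L: "L > 0" and \<epsilon>: "\<epsilon> \<ge> 0" and \<kappa>: "0 \<le> \<kappa>" "\<kappa> \<le> 1" and \<theta>: "\<theta> > 0"
    and tail: "\<And>k. (\<Sum>x | x \<subseteq> I \<and> cmod (hat I (rot L F k) x) < \<theta>. (cmod (hat I (rot L F k) x))\<^sup>2) \<le> \<kappa>\<^sup>2"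
    and small: "\<And>d. d \<subseteq> I \<Longrightarrow> d \<noteq> {} \<Longrightarrow> mean_energy L I F d \<le> \<epsilon>"
  shows "mean_energy L I F {} \<le> (mean_energy L I F {})\<^sup>2 + \<epsilon> + 8 * \<kappa> + 2 * sqrt \<epsilon> / \<theta> ^ 4"
proof -
  define Q where "Q = mean_energy L I F {}"
  define P where "P k l = (\<Sum>a\<in>Pow I. (cmod (auto_corr I (rot L F k) a))\<^sup>2 *
      (cmod (auto_corr I (rot L F l) a))\<^sup>2) / 2 ^ card I" for k l
  let ?\<delta> = "8 * \<kappa> + 2 * sqrt \<epsilon> / \<theta> ^ 4"
  \<comment> \<open>Here \<open>k\<close> is fixed and supplies the spectrum \<Lambda>; only
    \<open>l\<close> is averaged.\<close>
  have row: "L * Q \<le> (\<Sum>l<L. P k l) + L * ?\<delta>" for k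
  proof -
    define \<Lambda> where "\<Lambda> = {x. x \<subseteq> I \<and> \<not> cmod (hat I (rot L F k) x) < \<theta>}"
    have fin: "finite \<Lambda>" using I by (simp add: \<Lambda>_def)
    have sub: "\<Lambda> \<subseteq> Pow I" by (auto simp: \<Lambda>_def)
    have "Pow I - \<Lambda> = {x. x \<subseteq> I \<and> cmod (hat I (rot L F k) x) < \<theta>}" by (auto simp: \<Lambda>_def)
    hence tl: "(\<Sum>x\<in>Pow I - \<Lambda>. (cmod (hat I (rot L F k) x))\<^sup>2) \<le> \<kappa>\<^sup>2" using tail by simp
    \<comment> \<open>Chebyshev: \<Lambda> has at most 1/\<theta>^2 elements, which leaves at most
      1/\<theta>^4 off-diagonal pairs.\<close>
    have card: "real (card \<Lambda>) \<le> 1 / \<theta>\<^sup>2"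
    proof -
      have "real (card \<Lambda>) * \<theta>\<^sup>2 = (\<Sum>x\<in>\<Lambda>. \<theta>\<^sup>2)" by simp
      also have "\<dots> \<le> (\<Sum>x\<in>\<Lambda>. (cmod (hat I (rot L F k) x))\<^sup>2)"
        using \<theta> by (intro sum_mono power_mono) (auto simp: \<Lambda>_def)
      also have "\<dots> \<le> (\<Sum>x\<in>Pow I. (cmod (hat I (rot L F k) x))\<^sup>2)"
        using I sub by (intro sum_mono2) auto
      also have "\<dots> = 1" by (rule unimod_hat_L2[OF I unimod_rot])
      finally show ?thesis using \<theta> by (simp add: field_simps)
    qed
    \<comment> \<open>Cauchy-Schwarz in \<open>l\<close> leads from the square roots back to the
      mean energy at \<open>d\<close>, which is small.\<close>
    have off: "(\<Sum>l<L. sqrt (spec_energy I (rot L F l) d)) \<le> L * sqrt \<epsilon>" if d: "d \<subseteq> I" "d \<noteq> {}" for d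
    proof -
      have "(\<Sum>l<L. \<bar>sqrt (spec_energy I (rot L F l) d)\<bar>) / L \<le> sqrt ((\<Sum>l<L. (sqrt (spec_energy I (rot L F l) d))\<^sup>2) / L)"
        by (rule mean_abs_le[OF L])
      also have "\<dots> = sqrt (mean_energy L I F d)"
        by (simp add: mean_energy_def spec_energy_nonneg)
      also have "\<dots> \<le> sqrt \<epsilon>" using small[OF d] by simp
      finally show ?thesis using L by (simp add: spec_energy_nonneg field_simps)
    qed
    have "L * Q = (\<Sum>l<L. spec_energy I (rot L F l) {})"
      using L by (simp add: Q_def mean_energy_def)
    also have "\<dots> = (\<Sum>l<L. spec_energy I (rot L F (k + l)) {})"
      by (rule sum_rot_shift[OF L, symmetric])
    also have "\<dots> \<le> (\<Sum>l<L. P k l + 8 * \<kappa> + 2 * (\<Sum>\<alpha>\<in>\<Lambda>. \<Sum>\<beta>\<in>\<Lambda> - {\<alpha>}. sqrt (spec_energy I (rot L F l) (\<alpha> \<oplus> \<beta>))))"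
      unfolding P_def rot_add[abs_def]
      by (intro sum_mono product_energy[OF I unimod_rot unimod_rot \<kappa> sub tl])
    also have "\<dots> = (\<Sum>l<L. P k l) + L * (8 * \<kappa>) + 2 * (\<Sum>l<L. \<Sum>\<alpha>\<in>\<Lambda>. \<Sum>\<beta>\<in>\<Lambda> - {\<alpha>}. sqrt (spec_energy I (rot L F l) (\<alpha> \<oplus> \<beta>)))"
      by (simp add: sum.distrib flip: sum_distrib_left)
    also have "(\<Sum>l<L. \<Sum>\<alpha>\<in>\<Lambda>. \<Sum>\<beta>\<in>\<Lambda> - {\<alpha>}. sqrt (spec_energy I (rot L F l) (\<alpha> \<oplus> \<beta>)))
        = (\<Sum>\<alpha>\<in>\<Lambda>. \<Sum>l<L. \<Sum>\<beta>\<in>\<Lambda> - {\<alpha>}. sqrt (spec_energy I (rot L F l) (\<alpha> \<oplus> \<beta>)))"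
      by (rule sum.swap)
    also have "\<dots> = (\<Sum>\<alpha>\<in>\<Lambda>. \<Sum>\<beta>\<in>\<Lambda> - {\<alpha>}. \<Sum>l<L. sqrt (spec_energy I (rot L F l) (\<alpha> \<oplus> \<beta>)))"
      by (intro sum.cong sum.swap refl)
    also have "\<dots> \<le> (\<Sum>\<alpha>\<in>\<Lambda>. \<Sum>\<beta>\<in>\<Lambda> - {\<alpha>}. L * sqrt \<epsilon>)"
      using sub by (intro sum_mono off sd_subset) auto
    also have "\<dots> \<le> 1 / \<theta> ^ 4 * (L * sqrt \<epsilon>)"
    proof -
      have e: "L * sqrt \<epsilon> \<ge> 0" using \<epsilon> by simp
      have "(\<Sum>\<alpha>\<in>\<Lambda>. \<Sum>\<beta>\<in>\<Lambda> - {\<alpha>}. L * sqrt \<epsilon>) \<le> (\<Sum>\<alpha>\<in>\<Lambda>. \<Sum>\<beta>\<in>\<Lambda>. L * sqrt \<epsilon>)"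
        using fin e by (intro sum_mono sum_mono2) auto
      also have "\<dots> = (real (card \<Lambda>) * real (card \<Lambda>)) * (L * sqrt \<epsilon>)" by simp
      also have "\<dots> \<le> (1 / \<theta>\<^sup>2 * (1 / \<theta>\<^sup>2)) * (L * sqrt \<epsilon>)"
        using card e \<theta> by (intro mult_right_mono mult_mono) auto
      finally show ?thesis by (simp add: power4_eq_xxxx power2_eq_square)
    qed
    finally show ?thesis by (simp add: algebra_simps)
  qed
  have "L * (L * Q) = (\<Sum>k<L. L * Q)" by simp
  also have "\<dots> \<le> (\<Sum>k<L. (\<Sum>l<L. P k l) + L * ?\<delta>)" by (intro sum_mono row)
  also have "\<dots> = (\<Sum>k<L. \<Sum>l<L. P k l) + L * (L * ?\<delta>)" by (simp add: sum.distrib)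
  also have "(\<Sum>k<L. \<Sum>l<L. P k l) = (real L)\<^sup>2 * (\<Sum>d\<in>Pow I. (mean_energy L I F d)\<^sup>2)"
    using sum_mean_energy_sq[OF I L, of F] L by (simp add: P_def field_simps)
  finally have "L * (L * Q) \<le> L * (L * ((\<Sum>d\<in>Pow I. (mean_energy L I F d)\<^sup>2) + ?\<delta>))"
    by (simp add: power2_eq_square algebra_simps)
  hence "Q \<le> (\<Sum>d\<in>Pow I. (mean_energy L I F d)\<^sup>2) + ?\<delta>" using L by simp
  also have "(\<Sum>d\<in>Pow I. (mean_energy L I F d)\<^sup>2) = Q\<^sup>2 + (\<Sum>d\<in>Pow I - {{}}. (mean_energy L I F d)\<^sup>2)"
    using I by (simp add: Q_def sum.remove[of "Pow I" "{}"])
  \<comment> \<open>The remaining squares are at most \<epsilon> times a total mass of at most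
    1.\<close>
  also have "(\<Sum>d\<in>Pow I - {{}}. (mean_energy L I F d)\<^sup>2) \<le> (\<Sum>d\<in>Pow I - {{}}. \<epsilon> * mean_energy L I F d)"
    unfolding power2_eq_square using small by (intro sum_mono mult_right_mono mean_energy_nonneg) auto
  also have "\<dots> = \<epsilon> * (1 - Q)"
    using I sum_mean_energy[OF I L, of F] by (simp add: Q_def sum_diff flip: sum_distrib_left)
  also have "\<dots> \<le> \<epsilon>" using \<epsilon> mean_energy_nonneg[of L I F "{}"] by (simp add: Q_def mult_left_le)
  finally show ?thesis by (simp add: Q_def)
qed

section \<open>Restriction to half cubes and bounded multipliers\<close>


text \<open>
  For \<open>i \<in> d\<close> this identifies \<open>Pow (I - {i})\<close> with the coset of the annihilator of \<open>d\<close> in \<open>Pow I\<close> on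
  which the character \<open>wal d\<close> is equal to \<open>s\<close>.
\<close>

definition half :: "'a set \<Rightarrow> 'a \<Rightarrow> real \<Rightarrow> 'a set \<Rightarrow> 'a set" where
  "half d i s J = (if wal d J = s then J else insert i J)"

lemma wal_insert:
  assumes "finite J" "i \<notin> J"
  shows "wal d (insert i J) = (if i \<in> d then - wal d J else wal d J)"
  using assms by (simp add: wal_def)

lemma half_Diff: "i \<notin> J \<Longrightarrow> half d i s J - {i} = J"
  by (auto simp: half_def)

lemma half_subset: "i \<in> I \<Longrightarrow> J \<subseteq> I - {i} \<Longrightarrow> half d i s J \<subseteq> I"
  by (auto simp: half_def)

lemma inj_on_half: "inj_on (half d i s) (Pow (I - {i}))"
proof (rule inj_on_inverseI)
  fix J assume "J \<in> Pow (I - {i})"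
  thus "half d i s J - {i} = J" by (intro half_Diff) auto
qed

text \<open>On the coset \<open>wal d\<close> is the constant \<open>s\<close>, and inserting
  \<open>i\<close> does not change \<open>wal x\<close> when \<open>i \<notin> x\<close>. Hence the
  frequencies \<open>x\<close> and \<open>x \<oplus> d\<close> merge there up to the sign.\<close>

lemma wal_half:
  assumes "finite I" "i \<in> d" "\<bar>s\<bar> = 1" "x \<subseteq> I - {i}" "J \<subseteq> I - {i}"
  shows "wal x (half d i s J) = wal x J" "wal (x \<oplus> d) (half d i s J) = s * wal x J"
proof -
  have J: "finite J" "i \<notin> J" "i \<notin> x" using assms finite_subset[of J I] by auto
  show *: "wal x (half d i s J) = wal x J" using J by (simp add: half_def wal_insert)
  have "wal d J = 1 \<or> wal d J = -1" "s = 1 \<or> s = -1" using abs_wal[of d J] assms(3) by linarith+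
  hence "wal d (half d i s J) = s" using J assms(2) by (auto simp: half_def wal_insert)
  thus "wal (x \<oplus> d) (half d i s J) = s * wal x J" by (simp add: wal_sd_left *)
qed

text \<open>Of \<open>y\<close> and \<open>y \<oplus> d\<close> exactly one omits \<open>i\<close>,
  so the subsets without \<open>i\<close> represent these pairs.\<close>

lemma sum_Pow_split:
  assumes "finite I" "i \<in> d" "d \<subseteq> I"
  shows "(\<Sum>y\<in>Pow I. f y) = (\<Sum>x\<in>Pow (I - {i}). f x + f (x \<oplus> d))"
proof -
  have img: "(\<lambda>x. x \<oplus> d) ` Pow (I - {i}) = {y. y \<subseteq> I \<and> i \<in> y}"
  proof safe
    fix y assume "y \<subseteq> I" "i \<in> y"
    hence "y = (y \<oplus> d) \<oplus> d" "y \<oplus> d \<in> Pow (I - {i})" using assms by (auto simp: sd_def)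
    thus "y \<in> (\<lambda>x. x \<oplus> d) ` Pow (I - {i})" by (rule image_eqI)
  qed (use assms in \<open>auto simp: sd_def\<close>)
  have inj: "inj_on (\<lambda>x. x \<oplus> d) (Pow (I - {i}))"
    by (rule inj_on_inverseI[of _ "\<lambda>x. x \<oplus> d"]) simp
  have "Pow I = Pow (I - {i}) \<union> {y. y \<subseteq> I \<and> i \<in> y}" by auto
  hence "(\<Sum>y\<in>Pow I. f y) = (\<Sum>y\<in>Pow (I - {i}). f y) + (\<Sum>y | y \<subseteq> I \<and> i \<in> y. f y)"
    using assms(1) by (simp only:) (rule sum.union_disjoint, auto)
  also have "(\<Sum>y | y \<subseteq> I \<and> i \<in> y. f y) = (\<Sum>x\<in>Pow (I - {i}). f (x \<oplus> d))"
    unfolding img[symmetric] by (simp add: sum.reindex[OF inj])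
  finally show ?thesis by (simp add: sum.distrib)
qed

lemma hat_half:
  assumes "finite I" "i \<in> d" "d \<subseteq> I" "\<bar>s\<bar> = 1" "x \<subseteq> I - {i}"
  shows "hat (I - {i}) (\<lambda>J. g (half d i s J)) x = hat I g x + s * hat I g (x \<oplus> d)"
proof -
  have "g (half d i s J) = (\<Sum>x\<in>Pow (I - {i}). (hat I g x + s * hat I g (x \<oplus> d)) * wal x J)"
    if J: "J \<subseteq> I - {i}" for J
  proof -
    have "g (half d i s J) = (\<Sum>y\<in>Pow I. hat I g y * wal y (half d i s J))"
      using assms J by (intro hat_inversion half_subset) auto
    also have "\<dots> = (\<Sum>x\<in>Pow (I - {i}). hat I g x * wal x (half d i s J)
        + hat I g (x \<oplus> d) * wal (x \<oplus> d) (half d i s J))"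
      using assms by (intro sum_Pow_split) auto
    also have "\<dots> = (\<Sum>x\<in>Pow (I - {i}). (hat I g x + s * hat I g (x \<oplus> d)) * wal x J)"
      by (intro sum.cong refl) (simp add: wal_half[OF assms(1,2,4) _ J] algebra_simps)
    finally show ?thesis .
  qed
  thus ?thesis
    using hat_synthesis[of "I - {i}" x "\<lambda>x. hat I g x + s * hat I g (x \<oplus> d)"] assms
    by (subst hat_cong[where g = "\<lambda>J. \<Sum>x\<in>Pow (I - {i}). (hat I g x + s * hat I g (x \<oplus> d)) * wal x J"]) auto
qed

text \<open>With m = |u|^2 + |v|^2 the squared moduli of the sum and the difference are m + r and m
  - r; their squares add up to 2m^2 + 2r^2, and the left side is 2m^2.\<close>

lemma norm_pow4_parallelogram:
  fixes u v :: complex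
  shows "2 * ((cmod u)\<^sup>2 * (cmod u)\<^sup>2 + (cmod v)\<^sup>2 * (cmod v)\<^sup>2 + 2 * ((cmod u)\<^sup>2 * (cmod v)\<^sup>2))
     \<le> (cmod (u + v))\<^sup>2 * (cmod (u + v))\<^sup>2 + (cmod (u - v))\<^sup>2 * (cmod (u - v))\<^sup>2"
proof -
  let ?m = "(cmod u)\<^sup>2 + (cmod v)\<^sup>2" and ?r = "2 * (Re u * Re v + Im u * Im v)"
  have "(cmod (u + v))\<^sup>2 = ?m + ?r" "(cmod (u - v))\<^sup>2 = ?m - ?r"
    unfolding cmod_power2 by (simp_all add: power2_eq_square algebra_simps)
  hence "(cmod (u + v))\<^sup>2 * (cmod (u + v))\<^sup>2 + (cmod (u - v))\<^sup>2 * (cmod (u - v))\<^sup>2 = 2 * (?m * ?m) + 2 * (?r * ?r)"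
    by (simp only:) (simp add: algebra_simps)
  moreover have "0 \<le> ?r * ?r" by simp
  ultimately show ?thesis by (simp add: algebra_simps)
qed

text \<open>For merged frequencies with coefficients u and v the energy at \<open>d\<close> counts
  |u|^2 |v|^2 in both orders and completes |u|^4 + |v|^4 to a square. The coefficients on the two
  cosets are u + v and u - v.\<close>

lemma spec_energy_half:
  assumes "finite I" "i \<in> d" "d \<subseteq> I"
  shows "2 * (spec_energy I g {} + spec_energy I g d)
    \<le> spec_energy (I - {i}) (\<lambda>J. g (half d i 1 J)) {} + spec_energy (I - {i}) (\<lambda>J. g (half d i (-1) J)) {}"
proof -
  let ?u = "hat I g" and ?n = "\<lambda>z. (cmod z)\<^sup>2"
  have e: "spec_energy I g {} + spec_energy I g d = (\<Sum>x\<in>Pow (I - {i}).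
      ?n (?u x) * ?n (?u x) + ?n (?u (x \<oplus> d)) * ?n (?u (x \<oplus> d)) + 2 * (?n (?u x) * ?n (?u (x \<oplus> d))))"
    unfolding spec_energy_def sum_Pow_split[OF assms] sum.distrib[symmetric]
    by (intro sum.cong refl) simp
  show ?thesis
    unfolding e unfolding sum_distrib_left spec_energy_def sum.distrib[symmetric]
  proof (rule sum_mono)
    fix x assume "x \<in> Pow (I - {i})"
    hence "hat (I - {i}) (\<lambda>J. g (half d i 1 J)) x = ?u x + ?u (x \<oplus> d)"
      "hat (I - {i}) (\<lambda>J. g (half d i (-1) J)) x = ?u x - ?u (x \<oplus> d)"
      using hat_half[OF assms, of 1 x g] hat_half[OF assms, of "-1" x g] by auto
    thus "2 * (?n (?u x) * ?n (?u x) + ?n (?u (x \<oplus> d)) * ?n (?u (x \<oplus> d)) + 2 * (?n (?u x) * ?n (?u (x \<oplus> d))))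
      \<le> ?n (hat (I - {i}) (\<lambda>J. g (half d i 1 J)) x) * ?n (hat (I - {i}) (\<lambda>J. g (half d i 1 J)) (x \<oplus> {}))
       + ?n (hat (I - {i}) (\<lambda>J. g (half d i (-1) J)) x) * ?n (hat (I - {i}) (\<lambda>J. g (half d i (-1) J)) (x \<oplus> {}))"
      using norm_pow4_parallelogram[of "?u x" "?u (x \<oplus> d)"] by simp
  qed
qed

lemma rot_comp: "rot L (\<lambda>J. F (\<phi> J)) k = (\<lambda>J. rot L F k (\<phi> J))"
  by (simp add: rot_def fun_eq_iff)

text \<open>One of the two cosets does at least as well as their average. The sign is chosen after
  averaging over \<open>k\<close>, so the same coset serves all rotations.\<close>

lemma mean_energy_half:
  assumes "finite I" "i \<in> d" "d \<subseteq> I"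
  shows "\<exists>s. \<bar>s\<bar> = 1 \<and> mean_energy L I F {} + mean_energy L I F d \<le> mean_energy L (I - {i}) (\<lambda>J. F (half d i s J)) {}"
proof -
  let ?m = "\<lambda>s. mean_energy L (I - {i}) (\<lambda>J. F (half d i s J)) {}"
  have "2 * (mean_energy L I F {} + mean_energy L I F d)
      = (\<Sum>k<L. 2 * (spec_energy I (rot L F k) {} + spec_energy I (rot L F k) d)) / L"
    by (simp add: mean_energy_def sum.distrib add_divide_distrib flip: sum_distrib_left)
  also have "\<dots> \<le> (\<Sum>k<L. spec_energy (I - {i}) (rot L (\<lambda>J. F (half d i 1 J)) k) {}
      + spec_energy (I - {i}) (rot L (\<lambda>J. F (half d i (-1) J)) k) {}) / L"
    unfolding rot_comp[of L F "half d i 1"] rot_comp[of L F "half d i (-1)"]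
    by (intro divide_right_mono sum_mono spec_energy_half assms) simp
  also have "\<dots> = ?m 1 + ?m (-1)"
    by (simp add: mean_energy_def sum.distrib add_divide_distrib)
  finally have "2 * (mean_energy L I F {} + mean_energy L I F d) \<le> ?m 1 + ?m (-1)" .
  moreover have "z \<le> x \<or> z \<le> y" if "2 * z \<le> x + y" for x y z :: real using that by auto
  ultimately have "mean_energy L I F {} + mean_energy L I F d \<le> ?m 1 \<or> mean_energy L I F {} + mean_energy L I F d \<le> ?m (-1)"
    by blast
  thus ?thesis by (metis abs_1 abs_minus_cancel)
qed

lemma separated_half:
  assumes "separated L I F" "i \<in> I"
  shows "separated L (I - {i}) (\<lambda>J. F (half d i s J))"
  unfolding separated_def
proof (intro allI impI)
  fix J K assume JK: "J \<subseteq> I - {i}" "K \<subseteq> I - {i}" "J \<noteq> K"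
  hence "half d i s J \<noteq> half d i s K" using inj_onD[OF inj_on_half, of d i s J K I] by auto
  moreover have "half d i s J \<subseteq> I" "half d i s K \<subseteq> I"
    using JK assms(2) by (auto intro!: half_subset del: subsetI)
  ultimately show "\<not> int L dvd 2 * (F (half d i s J) - F (half d i s K))"
    using assms(1)[unfolded separated_def] by blast
qed

text \<open>The rotations are uniformly bounded multipliers of Walsh sums on the cube.
  \<open>C\<close> bounds the p-th power of the operator norm; normalising the measure would change
  both sides by the same factor.\<close>

definition multiplier_bound :: "real \<Rightarrow> real \<Rightarrow> nat \<Rightarrow> 'a set \<Rightarrow> ('a set \<Rightarrow> int) \<Rightarrow> bool" where
  "multiplier_bound p C L I F \<longleftrightarrow> (\<forall>k a.
     (\<Sum>x\<in>Pow I. cmod (\<Sum>J\<in>Pow I. a J * rot L F k J * wal x J) powr p)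
       \<le> C * (\<Sum>x\<in>Pow I. cmod (\<Sum>J\<in>Pow I. a J * wal x J) powr p))"

text \<open>Coefficients on the coset are extended by zero. The resulting Walsh sums have the same
  modulus at \<open>x\<close> and \<open>x \<oplus> d\<close>, so both sides of the inequality
  double.\<close>

lemma multiplier_bound_half:
  assumes bd: "multiplier_bound p C L I F" and I: "finite I" "i \<in> d" "d \<subseteq> I" and s: "\<bar>s\<bar> = 1"
  shows "multiplier_bound p C L (I - {i}) (\<lambda>J. F (half d i s J))"
  unfolding multiplier_bound_def
proof (intro allI)
  fix k and a :: "'a set \<Rightarrow> complex"
  let ?\<psi> = "half d i s" and ?I = "I - {i}"
  define b where "b K = (if K \<in> ?\<psi> ` Pow ?I then a (K - {i}) else 0)" for K
  have i: "i \<in> I" using I by auto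
  have img: "?\<psi> ` Pow ?I \<subseteq> Pow I" using half_subset[OF i] by blast
  have key: "(\<Sum>y\<in>Pow I. cmod (\<Sum>K\<in>Pow I. b K * g K * wal y K) powr p)
     = 2 * (\<Sum>x\<in>Pow ?I. cmod (\<Sum>J\<in>Pow ?I. a J * g (?\<psi> J) * wal x J) powr p)" for g :: "'a set \<Rightarrow> complex"
  proof -
    let ?Z = "\<lambda>x. \<Sum>J\<in>Pow ?I. a J * g (?\<psi> J) * wal x J"
    have *: "(\<Sum>K\<in>Pow I. b K * g K * wal y K) = (\<Sum>J\<in>Pow ?I. a J * g (?\<psi> J) * wal y (?\<psi> J))" for y
    proof -
      have "(\<Sum>K\<in>Pow I. b K * g K * wal y K) = (\<Sum>K\<in>?\<psi> ` Pow ?I. a (K - {i}) * g K * wal y K)"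
        by (rule sum.mono_neutral_cong_right) (use I img in \<open>auto simp: b_def\<close>)
      also have "\<dots> = (\<Sum>J\<in>Pow ?I. a (?\<psi> J - {i}) * g (?\<psi> J) * wal y (?\<psi> J))"
        by (simp add: sum.reindex[OF inj_on_half])
      also have "\<dots> = (\<Sum>J\<in>Pow ?I. a J * g (?\<psi> J) * wal y (?\<psi> J))"
      proof (intro sum.cong refl)
        fix J assume "J \<in> Pow ?I"
        hence "?\<psi> J - {i} = J" by (intro half_Diff) auto
        thus "a (?\<psi> J - {i}) * g (?\<psi> J) * wal y (?\<psi> J) = a J * g (?\<psi> J) * wal y (?\<psi> J)" by simp
      qed
      finally show ?thesis .
    qed
    have 1: "(\<Sum>K\<in>Pow I. b K * g K * wal x K) = ?Z x"
      and 2: "(\<Sum>K\<in>Pow I. b K * g K * wal (x \<oplus> d) K) = s * ?Z x" if "x \<in> Pow ?I" for x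
      unfolding * sum_distrib_left using that
      by (auto intro!: sum.cong simp: wal_half[OF I(1,2) s])
    let ?h = "\<lambda>y. cmod (\<Sum>K\<in>Pow I. b K * g K * wal y K) powr p"
    have "(\<Sum>y\<in>Pow I. ?h y) = (\<Sum>x\<in>Pow ?I. ?h x + ?h (x \<oplus> d))"
      by (rule sum_Pow_split[OF I])
    also have "\<dots> = (\<Sum>x\<in>Pow ?I. 2 * cmod (?Z x) powr p)"
      by (intro sum.cong refl) (simp only: 1 2 norm_mult norm_of_real s mult_1_left mult_2)
    finally show ?thesis by (simp add: sum_distrib_left)
  qed
  have "(\<Sum>y\<in>Pow I. cmod (\<Sum>K\<in>Pow I. b K * rot L F k K * wal y K) powr p)
      \<le> C * (\<Sum>y\<in>Pow I. cmod (\<Sum>K\<in>Pow I. b K * 1 * wal y K) powr p)"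
    using bd by (simp add: multiplier_bound_def)
  thus "(\<Sum>x\<in>Pow ?I. cmod (\<Sum>J\<in>Pow ?I. a J * rot L (\<lambda>J. F (?\<psi> J)) k J * wal x J) powr p)
       \<le> C * (\<Sum>x\<in>Pow ?I. cmod (\<Sum>J\<in>Pow ?I. a J * wal x J) powr p)"
    unfolding key rot_comp[of L F ?\<psi>] by simp
qed

text \<open>The lower bound on the energy measures the room left below 1. Each bad \<open>d\<close>
  leads to a coset of one dimension less whose energy is larger by more than \<epsilon>, so fewer
  than \<open>m\<close> such steps are possible.\<close>

lemma energy_increment:
  fixes I :: "'a set"
  assumes "finite I" "L > 0" "separated L I F" "multiplier_bound p C L I F" "\<epsilon> > 0"
    and "card I \<ge> n + m" "mean_energy L I F {} > 1 - real m * \<epsilon>"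
  shows "\<exists>(I' :: 'a set) F'. finite I' \<and> card I' \<ge> n \<and> separated L I' F' \<and> multiplier_bound p C L I' F' \<and>
    (\<forall>d\<subseteq>I'. d \<noteq> {} \<longrightarrow> mean_energy L I' F' d \<le> \<epsilon>)"
  using assms
proof (induction m arbitrary: I F)
  \<comment> \<open>No room is left: the energy would exceed 1.\<close>
  case 0
  thus ?case using mean_energy_le_1[of I L "{}" F] by simp
next
  case (Suc m)
  show ?case
  proof (cases "\<forall>d\<subseteq>I. d \<noteq> {} \<longrightarrow> mean_energy L I F d \<le> \<epsilon>")
    case True
    have "card I \<ge> n" using Suc.prems(6) by simp
    show ?thesis by (rule exI[of _ I], rule exI[of _ F], intro conjI) fact+
  next
    case False
    then obtain d i where d: "d \<subseteq> I" "i \<in> d" "mean_energy L I F d > \<epsilon>" by (auto simp: not_le)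
    then obtain s where s: "\<bar>s\<bar> = 1" "mean_energy L I F {} + mean_energy L I F d \<le> mean_energy L (I - {i}) (\<lambda>J. F (half d i s J)) {}"
      using mean_energy_half[OF Suc.prems(1), of i d] by blast
    have i: "i \<in> I" using d by auto
    show ?thesis
    proof (rule Suc.IH)
      show "separated L (I - {i}) (\<lambda>J. F (half d i s J))" using Suc.prems i by (intro separated_half)
      show "multiplier_bound p C L (I - {i}) (\<lambda>J. F (half d i s J))"
        using Suc.prems d s by (intro multiplier_bound_half)
      show "mean_energy L (I - {i}) (\<lambda>J. F (half d i s J)) {} > 1 - real m * \<epsilon>"
        using s(2) d(3) Suc.prems(7) by (simp add: algebra_simps)
      show "card (I - {i}) \<ge> n + m" using Suc.prems(1,6) i by simp
    qed (use Suc.prems in auto)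
  qed
qed

text \<open>With all coefficients equal to 1 the Walsh sum is a point mass at \<open>{}\<close> of
  size \<open>?N\<close>, and the multiplier maps it to \<open>?N\<close> times \<open>hat\<close>.
  This is the estimate for p < 2.\<close>

lemma multiplier_hat_sum_lt:
  assumes bd: "multiplier_bound p C L I F" and I: "finite I"
  shows "(\<Sum>x\<in>Pow I. cmod (hat I (rot L F k) x) powr p) \<le> C"
proof -
  let ?N = "2 ^ card I :: real"
  have N: "?N powr p > 0" by simp
  have "(\<Sum>x\<in>Pow I. cmod (\<Sum>J\<in>Pow I. 1 * rot L F k J * wal x J) powr p)
      \<le> C * (\<Sum>x\<in>Pow I. cmod (\<Sum>J\<in>Pow I. 1 * wal x J) powr p)"
    using bd[unfolded multiplier_bound_def, rule_format, of "\<lambda>_. 1" k] by simp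
  also have "(\<Sum>x\<in>Pow I. cmod (\<Sum>J\<in>Pow I. 1 * wal x J) powr p) = (\<Sum>x\<in>Pow I. if x = {} then ?N powr p else 0)"
  proof (intro sum.cong refl)
    fix x assume "x \<in> Pow I"
    hence "(\<Sum>J\<in>Pow I. 1 * complex_of_real (wal x J)) = complex_of_real (if x = {} then ?N else 0)"
      using sum_wal[OF I, of x] by (simp flip: of_real_sum)
    thus "cmod (\<Sum>J\<in>Pow I. 1 * wal x J) powr p = (if x = {} then ?N powr p else 0)"
      by (cases "x = {}") (simp_all add: norm_power)
  qed
  also have "\<dots> = ?N powr p" using I by simp
  also have "(\<Sum>x\<in>Pow I. cmod (\<Sum>J\<in>Pow I. 1 * rot L F k J * wal x J) powr p)
      = (\<Sum>x\<in>Pow I. cmod (hat I (rot L F k) x) powr p) * ?N powr p"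
    by (simp add: hat_def norm_divide norm_power powr_divide sum_distrib_right)
  finally show ?thesis using N by (simp add: mult_le_cancel_right)
qed

text \<open>For \<open>p > 2\<close> the kernel of the multiplier is tested against its own dual function; evaluating
  the result at one point costs nothing in a counting norm.\<close>

lemma multiplier_hat_sum_gt:
  assumes bd: "multiplier_bound p C L I F" and I: "finite I" and p: "p > 1"
  shows "(\<Sum>x\<in>Pow I. cmod (hat I (rot L F k) x) powr (p / (p - 1))) \<le> C powr (1 / (p - 1))"
proof -
  let ?N = "2 ^ card I :: real" and ?c = "hat I (rot L F k)" and ?q = "p / (p - 1)"
  \<comment> \<open>The extremal function of Hoelder's inequality for the kernel \<open>?c\<close>:
    both its p-th power and its product with \<open>?c\<close> are |?c|^q.\<close>
  define \<phi> where "\<phi> x = cnj (?c x) * (cmod (?c x) powr (?q - 2))" for x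
  define a where "a = hat I \<phi>"
  define S where "S = (\<Sum>x\<in>Pow I. cmod (?c x) powr ?q)"
  have finI: "finite K" if "K \<subseteq> I" for K using that I finite_subset by blast
  have a: "(\<Sum>J\<in>Pow I. a J * wal x J) = \<phi> x" if "x \<subseteq> I" for x
    using hat_inversion[OF I that, of \<phi>] that finI
    by (simp add: a_def wal_commute[of x])
  have n\<phi>: "cmod (\<phi> x) powr p = cmod (?c x) powr ?q" for x
  proof (cases "?c x = 0")
    case False
    hence "cmod (\<phi> x) = cmod (?c x) powr (?q - 1)"
      by (simp add: \<phi>_def norm_mult powr_mult_base)
    moreover have "(?q - 1) * p = ?q" using p by (simp add: field_simps)
    ultimately show ?thesis by (simp only: powr_powr)
  qed (simp add: \<phi>_def)
  have c\<phi>: "?c x * \<phi> x = complex_of_real (cmod (?c x) powr ?q)" for x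
  proof (cases "?c x = 0")
    case False
    have "?c x * \<phi> x = complex_of_real ((cmod (?c x))\<^sup>2) * (cmod (?c x) powr (?q - 2))"
      unfolding \<phi>_def complex_norm_square by simp
    also have "\<dots> = complex_of_real (cmod (?c x) powr ?q)"
      unfolding of_real_mult[symmetric] using False by (simp flip: powr_add powr_numeral)
    finally show ?thesis .
  qed (simp add: \<phi>_def)
  \<comment> \<open>At the point \<open>{}\<close> the image of \<phi> is its pairing with the
    kernel, which is \<open>S\<close>.\<close>
  have "(\<Sum>J\<in>Pow I. a J * rot L F k J * wal {} J) = (\<Sum>J\<in>Pow I. \<Sum>x\<in>Pow I. \<phi> x * (rot L F k J * wal x J) / ?N)"
  proof (intro sum.cong refl)
    fix J assume J: "J \<in> Pow I"
    show "a J * rot L F k J * wal {} J = (\<Sum>x\<in>Pow I. \<phi> x * (rot L F k J * wal x J) / ?N)"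
      unfolding a_def hat_def using J finI
      by (auto simp: sum_divide_distrib sum_distrib_right wal_commute[of J] intro!: sum.cong)
  qed
  also have "\<dots> = (\<Sum>x\<in>Pow I. \<Sum>J\<in>Pow I. \<phi> x * (rot L F k J * wal x J) / ?N)" by (rule sum.swap)
  also have "\<dots> = (\<Sum>x\<in>Pow I. \<phi> x * ?c x)"
    unfolding hat_def by (simp add: sum_distrib_left sum_divide_distrib)
  also have "\<dots> = complex_of_real S" using c\<phi> by (simp add: S_def mult.commute)
  finally have pt: "(\<Sum>J\<in>Pow I. a J * rot L F k J * wal {} J) = complex_of_real S" .
  have S0: "S \<ge> 0" by (simp add: S_def sum_nonneg)
  have "S powr p = cmod (\<Sum>J\<in>Pow I. a J * rot L F k J * wal {} J) powr p" using S0 by (simp only: pt norm_of_real abs_of_nonneg)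
  also have "\<dots> \<le> (\<Sum>x\<in>Pow I. cmod (\<Sum>J\<in>Pow I. a J * rot L F k J * wal x J) powr p)"
    using I by (intro member_le_sum[of "{}" "Pow I" "\<lambda>x. cmod (\<Sum>J\<in>Pow I. a J * rot L F k J * wal x J) powr p"]) auto
  also have "\<dots> \<le> C * (\<Sum>x\<in>Pow I. cmod (\<Sum>J\<in>Pow I. a J * wal x J) powr p)"
    using bd by (simp add: multiplier_bound_def)
  also have "(\<Sum>x\<in>Pow I. cmod (\<Sum>J\<in>Pow I. a J * wal x J) powr p) = S"
    unfolding S_def by (intro sum.cong refl) (simp add: a n\<phi>)
  \<comment> \<open>One point is kept on the left and all of them on the right; one factor
    \<open>S\<close> then cancels.\<close>
  finally have main: "S powr p \<le> C * S" .
  show ?thesis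
  proof (cases "S = 0")
    case False
    hence S: "S > 0" using S0 by simp
    have "S powr p = S powr (p - 1) * S" using S by (simp add: powr_mult_base mult.commute)
    hence "S powr (p - 1) \<le> C" using main S by simp
    hence "(S powr (p - 1)) powr (1 / (p - 1)) \<le> C powr (1 / (p - 1))"
      using p by (intro powr_mono2) auto
    thus ?thesis using p S by (simp add: powr_powr S_def)
  qed (simp flip: S_def)
qed

text \<open>Below \<theta> one has |c|^2 \<le> \<theta>^(2-q) |c|^q, so a bound on the sum of q-th
  powers with q < 2 controls the tail. As p \<noteq> 2, either \<open>p\<close> or its conjugate
  exponent serves as q, and \<theta> is the same for all cubes and rotations.\<close>

lemma tail_small:
  assumes p: "p > 1" "p \<noteq> 2" and \<kappa>: "\<kappa> > 0"
  obtains \<theta> where "\<theta> > 0" "\<And>L I (F :: 'a set \<Rightarrow> int) k. finite I \<Longrightarrow> multiplier_bound p C L I F \<Longrightarrow>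
    (\<Sum>x | x \<subseteq> I \<and> cmod (hat I (rot L F k) x) < \<theta>. (cmod (hat I (rot L F k) x))\<^sup>2) \<le> \<kappa>"
proof -
  obtain q B where q: "q < 2" and B: "\<And>L I (F :: 'a set \<Rightarrow> int) k. finite I \<Longrightarrow> multiplier_bound p C L I F \<Longrightarrow>
    (\<Sum>x\<in>Pow I. cmod (hat I (rot L F k) x) powr q) \<le> B"
  proof (cases "p < 2")
    case True
    thus ?thesis using multiplier_hat_sum_lt that by blast
  next
    case False
    hence "p / (p - 1) < 2" using p by (simp add: field_simps)
    thus ?thesis using multiplier_hat_sum_gt p(1) that by blast
  qed
  \<comment> \<open>Chosen to solve \<theta>^(2-q) max(B, 1) = \<kappa>; the maximum keeps the
    denominator positive.\<close>
  define \<theta> where "\<theta> = (\<kappa> / max B 1) powr (1 / (2 - q))"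
  have \<theta>: "\<theta> > 0" using \<kappa> by (simp add: \<theta>_def)
  have \<theta>B: "\<theta> powr (2 - q) * max B 1 = \<kappa>" using \<kappa> q by (simp add: \<theta>_def powr_powr)
  show ?thesis
  proof (rule that[OF \<theta>])
    fix L I k and F :: "'a set \<Rightarrow> int"
    assume I: "finite I" and bd: "multiplier_bound p C L I F"
    let ?c = "\<lambda>x. cmod (hat I (rot L F k) x)"
    have "(\<Sum>x | x \<subseteq> I \<and> ?c x < \<theta>. (?c x)\<^sup>2) \<le> (\<Sum>x | x \<subseteq> I \<and> ?c x < \<theta>. \<theta> powr (2 - q) * ?c x powr q)"
    proof (rule sum_mono)
      fix x assume x: "x \<in> {x. x \<subseteq> I \<and> ?c x < \<theta>}"
      show "(?c x)\<^sup>2 \<le> \<theta> powr (2 - q) * ?c x powr q"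
      proof (cases "?c x = 0")
        case False
        hence "(?c x)\<^sup>2 = ?c x powr (2 - q) * ?c x powr q"
          by (simp flip: powr_add powr_numeral)
        also have "\<dots> \<le> \<theta> powr (2 - q) * ?c x powr q"
          using x q by (intro mult_right_mono powr_mono2) auto
        finally show ?thesis .
      qed simp
    qed
    also have "\<dots> = \<theta> powr (2 - q) * (\<Sum>x | x \<subseteq> I \<and> ?c x < \<theta>. ?c x powr q)"
      by (simp add: sum_distrib_left)
    also have "\<dots> \<le> \<theta> powr (2 - q) * (\<Sum>x\<in>Pow I. ?c x powr q)"
      using I by (intro mult_left_mono sum_mono2) auto
    also have "\<dots> \<le> \<theta> powr (2 - q) * max B 1"
      using B[OF I bd, of k] by (intro mult_left_mono) auto
    finally show "(\<Sum>x | x \<subseteq> I \<and> ?c x < \<theta>. (?c x)\<^sup>2) \<le> \<kappa>" by (simp add: \<theta>B)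
  qed
qed

text \<open>At least half of the mass sits on coefficients of modulus at least \<theta>, where the
  fourth power is at least \<theta>^2 times the square.\<close>

lemma spec_energy_ge:
  assumes I: "finite I" and g: "unimod I g" and \<theta>: "\<theta> > 0"
    and tail: "(\<Sum>x | x \<subseteq> I \<and> cmod (hat I g x) < \<theta>. (cmod (hat I g x))\<^sup>2) \<le> 1 / 2"
  shows "spec_energy I g {} \<ge> \<theta>\<^sup>2 / 2"
proof -
  let ?u = "\<lambda>x. (cmod (hat I g x))\<^sup>2"
  let ?A = "{x. x \<subseteq> I \<and> cmod (hat I g x) < \<theta>}"
  have A: "?A \<subseteq> Pow I" by auto
  have "1 = (\<Sum>x\<in>Pow I - ?A. ?u x) + (\<Sum>x\<in>?A. ?u x)"
    using sum.subset_diff[OF A, of ?u] I unimod_hat_L2[OF I g] by simp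
  hence "\<theta>\<^sup>2 / 2 \<le> (\<Sum>x\<in>Pow I - ?A. ?u x) * \<theta>\<^sup>2" using tail \<theta> by simp
  also have "\<dots> \<le> (\<Sum>x\<in>Pow I - ?A. ?u x * ?u x)"
    unfolding sum_distrib_right using \<theta> by (intro sum_mono mult_left_mono power_mono) auto
  also have "\<dots> \<le> (\<Sum>x\<in>Pow I. ?u x * ?u x)" using I by (intro sum_mono2) auto
  finally show ?thesis by (simp add: spec_energy_def)
qed

text \<open>A cube of large dimension contains one on which all \<open>d \<noteq> {}\<close> have
  small mean energy. There c \<le> Q \<le> 3/4 keeps Q(1 - Q) at least c/4, while near idempotence
  makes it smaller.\<close>

lemma multiplier_dimension_bounded:
  fixes p C :: real
  assumes p: "p > 1" "p \<noteq> 2"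
  obtains N where "\<And>L I (F :: 'a set \<Rightarrow> int). finite I \<Longrightarrow> L > 0 \<Longrightarrow> separated L I F \<Longrightarrow>
    multiplier_bound p C L I F \<Longrightarrow> card I < N"
proof -
  obtain \<theta>0 where \<theta>0: "\<theta>0 > 0" "\<And>L I (F :: 'a set \<Rightarrow> int) k. finite I \<Longrightarrow> multiplier_bound p C L I F \<Longrightarrow>
    (\<Sum>x | x \<subseteq> I \<and> cmod (hat I (rot L F k) x) < \<theta>0. (cmod (hat I (rot L F k) x))\<^sup>2) \<le> 1 / 2"
    using tail_small[OF p, of "1 / 2"] by auto
  \<comment> \<open>A lower bound for the energy of every rotation, by
    \<open>spec_energy_ge\<close>.\<close>
  define c where "c = min 1 (\<theta>0\<^sup>2 / 2)"
  have c: "c > 0" "c \<le> 1" using \<theta>0(1) by (auto simp: c_def)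
  define \<kappa> where "\<kappa> = c / 100"
  have \<kappa>: "\<kappa> > 0" "\<kappa> \<le> 1" using c by (auto simp: \<kappa>_def)
  obtain \<theta> where \<theta>: "\<theta> > 0" "\<And>L I (F :: 'a set \<Rightarrow> int) k. finite I \<Longrightarrow> multiplier_bound p C L I F \<Longrightarrow>
    (\<Sum>x | x \<subseteq> I \<and> cmod (hat I (rot L F k) x) < \<theta>. (cmod (hat I (rot L F k) x))\<^sup>2) \<le> \<kappa>\<^sup>2"
    using tail_small[OF p, of "\<kappa>\<^sup>2"] \<kappa> by auto
  \<comment> \<open>Makes the three errors at most c/100, 8c/100 and 2c/100, in total below
    c/4.\<close>
  define \<epsilon> where "\<epsilon> = min (c / 100) ((c * \<theta> ^ 4 / 100)\<^sup>2)"
  have \<epsilon>: "\<epsilon> > 0" using c \<theta>(1) by (simp add: \<epsilon>_def)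
  have "sqrt \<epsilon> \<le> sqrt ((c * \<theta> ^ 4 / 100)\<^sup>2)" by (rule real_sqrt_le_mono) (simp add: \<epsilon>_def)
  also have "\<dots> = c * \<theta> ^ 4 / 100" using c \<theta>(1) by simp
  finally have "2 * sqrt \<epsilon> / \<theta> ^ 4 \<le> c / 50" using \<theta>(1) by (simp add: field_simps)
  moreover have "\<epsilon> \<le> c / 100" by (simp add: \<epsilon>_def)
  ultimately have err: "\<epsilon> + 8 * \<kappa> + 2 * sqrt \<epsilon> / \<theta> ^ 4 < c / 4" using c by (simp add: \<kappa>_def)
  \<comment> \<open>With this \<open>m\<close> the increment argument may start from the trivial
    bound that energies are nonnegative.\<close>
  obtain m :: nat where m: "1 < real m * \<epsilon>" using reals_Archimedean3[OF \<epsilon>] by blast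
  show ?thesis
  \<comment> \<open>Up to \<open>m\<close> dimensions may be lost; the bound 3/4 needs the remaining
    2.\<close>
  proof (rule that[of "2 + m"], rule ccontr)
    fix L I and F :: "'a set \<Rightarrow> int"
    assume *: "finite I" "L > 0" "separated L I F" "multiplier_bound p C L I F" "\<not> card I < 2 + m"
    have "mean_energy L I F {} > 1 - real m * \<epsilon>" using mean_energy_nonneg[of L I F "{}"] m by linarith
    then obtain I' and F' :: "'a set \<Rightarrow> int" where I': "finite I'" "card I' \<ge> 2" "separated L I' F'" "multiplier_bound p C L I' F'"
      "\<And>d. d \<subseteq> I' \<Longrightarrow> d \<noteq> {} \<Longrightarrow> mean_energy L I' F' d \<le> \<epsilon>"
      using energy_increment[OF *(1-4) \<epsilon>, of 2 m] *(5) by auto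
    define Q where "Q = mean_energy L I' F' {}"
    have "Q \<le> Q\<^sup>2 + \<epsilon> + 8 * \<kappa> + 2 * sqrt \<epsilon> / \<theta> ^ 4" unfolding Q_def
      using \<kappa> \<epsilon> by (intro mean_energy_almost_idempotent[OF I'(1) *(2) _ _ _ \<theta>(1)] \<theta>(2) I') auto
    hence "Q - Q\<^sup>2 < c / 4" using err by linarith
    hence 1: "Q * (1 - Q) < c / 4" by (simp add: power2_eq_square algebra_simps)
    have 2: "Q \<le> 3 / 4" unfolding Q_def by (rule mean_energy_le_three_quarters[OF I'(1,2) *(2) I'(3)])
    have "Q \<ge> (\<Sum>k<L. c) / L" unfolding Q_def mean_energy_def
    proof (intro divide_right_mono sum_mono)
      fix k show "c \<le> spec_energy I' (rot L F' k) {}"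
        using spec_energy_ge[OF I'(1) unimod_rot \<theta>0(1) \<theta>0(2)[OF I'(1,4)], of k] by (simp add: c_def)
    qed simp
    hence 3: "Q \<ge> c" using *(2) by simp
    have "c * (1 / 4) \<le> Q * (1 - Q)" using 2 3 c by (intro mult_mono) auto
    thus False using 1 by simp
  qed
qed

section \<open>From \<open>L\<^sub>p[0,1)\<close> to the cube\<close>


definition Lp_pow :: "real \<Rightarrow> (real \<Rightarrow> complex) \<Rightarrow> real" where
  "Lp_pow p f = (LINT x|leb01. norm (f x) powr p)"

definition dyad :: "nat \<Rightarrow> nat set \<Rightarrow> real set" where
  "dyad n x = {t\<in>{0..<1}. \<forall>j<n. rademacher j t = (if j \<in> x then -1 else 1)}"

text \<open>\<open>rademacher n\<close> changes sign at the midpoint of each dyadic interval of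
  length 2^-n, and -1 belongs to the right half.\<close>

lemma dyad_eq_interval: "\<exists>m :: nat. dyad n x = {real m / 2 ^ n ..< (real m + 1) / 2 ^ n}"
proof (induction n)
  case 0
  show ?case by (intro exI[of _ 0]) (auto simp: dyad_def)
next
  case (Suc n)
  then obtain m where m: "dyad n x = {real m / 2 ^ n ..< (real m + 1) / 2 ^ n}" by blast
  have r: "rademacher n t = 1 \<longleftrightarrow> t < (2 * real m + 1) / 2 ^ Suc n" if "t \<in> dyad n x" for t
  proof -
    have b: "real m \<le> 2 ^ n * t" "2 ^ n * t < real m + 1" using that unfolding m by (auto simp: field_simps)
    hence "\<lfloor>2 ^ n * t\<rfloor> = int m" by (intro floor_unique) auto
    thus ?thesis by (simp add: rademacher_def field_simps)
  qed
  have r2: "rademacher n t = 1 \<or> rademacher n t = -1" for t by (simp add: rademacher_def)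
  have D: "dyad (Suc n) x = {t \<in> dyad n x. rademacher n t = (if n \<in> x then -1 else 1)}"
    by (auto simp: dyad_def less_Suc_eq)
  show ?case
  proof (cases "n \<in> x")
    case True
    hence "dyad (Suc n) x = {t \<in> dyad n x. (2 * real m + 1) / 2 ^ Suc n \<le> t}"
      unfolding D using r r2 by force
    also have "\<dots> = {real (2 * m + 1) / 2 ^ Suc n ..< (real (2 * m + 1) + 1) / 2 ^ Suc n}"
      unfolding m by (auto simp: field_simps)
    finally show ?thesis by blast
  next
    case False
    hence "dyad (Suc n) x = {t \<in> dyad n x. t < (2 * real m + 1) / 2 ^ Suc n}"
      unfolding D using r by auto
    also have "\<dots> = {real (2 * m) / 2 ^ Suc n ..< (real (2 * m) + 1) / 2 ^ Suc n}"
      unfolding m by (auto simp: field_simps)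
    finally show ?thesis by blast
  qed
qed

lemma dyad_subset: "dyad n x \<subseteq> {0..<1}"
  by (auto simp: dyad_def)

lemma dyad_sets: "dyad n x \<in> sets leb01"
  using dyad_eq_interval[of n x] dyad_subset[of n x]
  by (auto simp: sets_restrict_space_iff)

lemma measure_dyad: "measure leb01 (dyad n x) = 1 / 2 ^ n"
proof -
  obtain m :: nat where m: "dyad n x = {real m / 2 ^ n ..< (real m + 1) / 2 ^ n}"
    using dyad_eq_interval by blast
  have "measure leb01 (dyad n x) = measure lebesgue (dyad n x)"
    using dyad_subset by (intro measure_restrict_space) auto
  also have "\<dots> = measure lborel {real m / 2 ^ n ..< (real m + 1) / 2 ^ n}"
    unfolding m by (rule measure_completion) simp
  also have "\<dots> = 1 / 2 ^ n" by (simp add: divide_right_mono flip: diff_divide_distrib)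
  finally show ?thesis .
qed

lemma walsh_on_dyad:
  assumes "J \<subseteq> {..<n}" "t \<in> dyad n x"
  shows "walsh J t = wal x J"
proof -
  have "(\<Prod>j\<in>J. rademacher j t) = wal x J"
    unfolding wal_def using assms by (intro prod.cong) (auto simp: dyad_def)
  thus ?thesis using assms by (auto simp: walsh_def dyad_def simp flip: of_real_prod)
qed

lemma mem_dyad: "t \<in> {0..<1} \<Longrightarrow> t \<in> dyad n {j. j < n \<and> rademacher j t = -1}"
  by (auto simp: dyad_def rademacher_def)

lemma dyad_unique:
  assumes "t \<in> dyad n x" "t \<in> dyad n y" "x \<subseteq> {..<n}" "y \<subseteq> {..<n}"
  shows "x = y"
proof -
  have "j \<in> x \<longleftrightarrow> j \<in> y" if "j < n" for j
    using assms(1,2) that by (auto simp: dyad_def split: if_splits)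
  thus ?thesis using assms(3,4) by auto
qed

text \<open>Such a polynomial is constant on each of the 2^n dyadic intervals of length 2^-n, with
  the Walsh sum on the cube as its value.\<close>

lemma Lp_pow_walsh:
  "Lp_pow p (\<lambda>t. \<Sum>J\<in>Pow {..<n}. a J * walsh J t)
     = (\<Sum>x\<in>Pow {..<n}. cmod (\<Sum>J\<in>Pow {..<n}. a J * wal x J) powr p) / 2 ^ n"
proof -
  let ?I = "{..<n}"
  let ?c = "\<lambda>x. cmod (\<Sum>J\<in>Pow ?I. a J * wal x J) powr p"
  have "Lp_pow p (\<lambda>t. \<Sum>J\<in>Pow ?I. a J * walsh J t) = (LINT t|leb01. (\<Sum>x\<in>Pow ?I. ?c x * indicator (dyad n x) t))"
    unfolding Lp_pow_def
  proof (rule Bochner_Integration.integral_cong[OF refl])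
    fix t assume "t \<in> space leb01"
    hence t: "t \<in> {0..<1}" by (simp add: space_restrict_space)
    define y where "y = {j. j < n \<and> rademacher j t = -1}"
    have y: "t \<in> dyad n y" "y \<subseteq> ?I" using mem_dyad[OF t, of n] by (auto simp: y_def)
    have "(\<Sum>x\<in>Pow ?I. ?c x * indicator (dyad n x) t) = (\<Sum>x\<in>Pow ?I. if x = y then ?c x else 0)"
    proof (intro sum.cong refl)
      fix x assume "x \<in> Pow ?I"
      hence "t \<in> dyad n x \<longleftrightarrow> x = y" using dyad_unique[of t n x y] y by auto
      thus "?c x * indicator (dyad n x) t = (if x = y then ?c x else 0)"
        by (auto simp: indicator_def)
    qed
    also have "\<dots> = ?c y" using y by simp
    also have "?c y = cmod (\<Sum>J\<in>Pow ?I. a J * walsh J t) powr p"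
      using y by (simp add: walsh_on_dyad)
    finally show "cmod (\<Sum>J\<in>Pow ?I. a J * walsh J t) powr p = (\<Sum>x\<in>Pow ?I. ?c x * indicator (dyad n x) t)" ..
  qed
  also have "\<dots> = (\<Sum>x\<in>Pow ?I. (LINT t|leb01. ?c x * indicator (dyad n x) t))"
  proof (rule Bochner_Integration.integral_sum)
    fix x
    have "finite_measure leb01"
      by (intro finite_measure_lebesgue_on bounded_set_imp_lmeasurable bounded_Ico) simp
    hence "emeasure leb01 (dyad n x) < \<infinity>"
      using finite_measure.emeasure_finite[of leb01 "dyad n x"] by (simp add: less_top)
    thus "integrable leb01 (\<lambda>t. ?c x * indicator (dyad n x) t)"
      using dyad_sets by (intro integrable_mult_right integrable_real_indicator)
  qed
  also have "\<dots> = (\<Sum>x\<in>Pow ?I. ?c x * (1 / 2 ^ n))"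
    using dyad_sets measure_dyad dyad_subset
    by (intro sum.cong refl) (simp add: Int_absorb2 space_restrict_space)
  finally show ?thesis by (simp add: sum_divide_distrib)
qed

text \<open>At a point whose only negative sign among the first \<open>n\<close> is the
  \<open>j\<close>-th, a Walsh function of these signs is -1 exactly if its index contains
  \<open>j\<close>. The left endpoint of \<open>dyad n {j}\<close> is such a point.\<close>

lemma walsh_inj:
  assumes "finite J" "finite K" "walsh J = walsh K"
  shows "J = K"
proof (rule ccontr)
  assume "J \<noteq> K"
  then obtain j where j: "j \<in> J \<oplus> K" by (metis equals0I sd_eq_empty_iff)
  have "finite (J \<union> K)" using assms by simp
  then obtain n where n: "J \<union> K \<subseteq> {..<n}" using finite_nat_iff_bounded by blast
  obtain m :: nat where m: "dyad n {j} = {real m / 2 ^ n ..< (real m + 1) / 2 ^ n}"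
    using dyad_eq_interval by blast
  have "real m / 2 ^ n \<in> dyad n {j}" unfolding m by (simp add: divide_strict_right_mono)
  hence "complex_of_real (wal {j} J) = wal {j} K"
    using n walsh_on_dyad[of J n _ "{j}"] walsh_on_dyad[of K n _ "{j}"] assms(3) by auto
  hence "wal {j} J = wal {j} K" by (simp only: of_real_eq_iff)
  hence "wal J {j} = wal K {j}" using assms by (simp add: wal_commute[of "{j}"])
  thus False using j by (auto simp: wal_def sd_def)
qed

section \<open>Translation invariance for trigonometric polynomials\<close>

lemma integral_periodic:
  fixes \<phi> :: "real \<Rightarrow> real"
  assumes cont: "continuous_on UNIV \<phi>" and per: "\<And>t. \<phi> (t + 1) = \<phi> t" and r: "r \<ge> 0"
  shows "integral {0..1} (\<lambda>t. \<phi> (t + r)) = integral {0..1} \<phi>"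
proof -
  have int: "\<phi> integrable_on {a..b}" for a b
    using cont by (intro integrable_continuous_real) (rule continuous_on_subset, auto)
  have "integral {0..1} (\<lambda>t. \<phi> (t + r)) = integral {r..1 + r} \<phi>"
    using integral_shift_real_ivl[of r r "1 + r" \<phi>] by simp
  moreover have "integral {0..r} \<phi> + integral {r..1 + r} \<phi> = integral {0..1 + r} \<phi>"
    using r int by (intro Henstock_Kurzweil_Integration.integral_combine) auto
  moreover have "integral {0..1} \<phi> + integral {1..1 + r} \<phi> = integral {0..1 + r} \<phi>"
    using r int by (intro Henstock_Kurzweil_Integration.integral_combine) auto
  moreover have "integral {1..1 + r} \<phi> = integral {0..r} \<phi>"
    using integral_shift_real_ivl[of 1 1 "1 + r" \<phi>] per by simp
  ultimately show ?thesis by simp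
qed

text \<open>The point 1 is negligible; on the closed interval the gauge integral can be shifted and
  split.\<close>

lemma integral_leb01:
  fixes \<phi> :: "real \<Rightarrow> real"
  assumes "continuous_on UNIV \<phi>"
  shows "(LINT t|leb01. \<phi> t) = integral {0..1} \<phi>"
proof -
  have "integrable (lebesgue_on {0..1}) \<phi>"
    using assms by (intro continuous_imp_integrable_real) (rule continuous_on_subset, auto)
  hence "set_integrable lebesgue {0..1} \<phi>"
    unfolding set_integrable_def by (subst (asm) integrable_restrict_space) auto
  hence "set_integrable lebesgue {0..<1} \<phi>" by (rule set_integrable_subset) auto
  hence "integrable leb01 \<phi>"
    unfolding set_integrable_def by (subst integrable_restrict_space) auto
  hence "(LINT t|leb01. \<phi> t) = integral {0..<1} \<phi>" by (rule lebesgue_integral_eq_integral) simp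
  also have "\<dots> = integral {0..1} \<phi>"
    by (rule integral_subset_negligible) (auto intro: negligible_subset[of "{1}"])
  finally show ?thesis .
qed

text \<open>Replacing t by t + k/L multiplies each exponential of frequency \<open>F J\<close> by
  \<open>rot L F k J\<close>, and the integral of a function of period 1 does not notice the
  translation.\<close>

lemma Lp_pow_trig_rot:
  assumes S: "finite S" and L: "L > 0" and p: "p > 0"
  shows "Lp_pow p (\<lambda>t. \<Sum>J\<in>S. a J * rot L F k J * trig (F J) t) = Lp_pow p (\<lambda>t. \<Sum>J\<in>S. a J * trig (F J) t)"
proof -
  \<comment> \<open>The exponentials are taken on the whole line, because translates leave [0,1),
    where \<open>trig\<close> is defined.\<close>
  define h where "h t = (\<Sum>J\<in>S. a J * exp (2 * of_real pi * \<i> * of_int (F J) * of_real t))" for t :: real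
  define \<phi> where "\<phi> t = cmod (h t) powr p" for t
  define r where "r = real k / real L"
  have cont: "continuous_on UNIV \<phi>"
    unfolding \<phi>_def h_def using p by (intro continuous_on_powr' continuous_intros) auto
  have cont': "continuous_on UNIV (\<lambda>t. \<phi> (t + r))"
    by (rule continuous_on_compose2[OF cont]) (auto intro!: continuous_intros)
  have per: "\<phi> (t + 1) = \<phi> t" for t
  proof -
    have "exp (2 * of_real pi * \<i> * of_int z * of_real (t + 1)) = (exp (2 * of_real pi * \<i> * of_int z * of_real t) :: complex)" for z
    proof -
      have "2 * of_real pi * \<i> * of_int z * of_real (t + 1)
         = 2 * of_real pi * \<i> * of_int z * of_real t + of_real (2 * of_int z * pi) * \<i>"
        by (simp add: algebra_simps)
      also have "exp \<dots> = exp (2 * of_real pi * \<i> * of_int z * of_real t) * (1 :: complex)"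
        unfolding exp_add by (subst exp_integer_2pi) auto
      finally show ?thesis by simp
    qed
    thus ?thesis by (simp add: \<phi>_def h_def)
  qed
  have rt: "rot L F k J * exp (2 * of_real pi * \<i> * of_int (F J) * of_real t)
      = exp (2 * of_real pi * \<i> * of_int (F J) * of_real (t + r))" for J t
    unfolding rot_def cis_conv_exp exp_add[symmetric] by (simp add: r_def algebra_simps)
  have \<phi>r: "\<phi> (t + r) = cmod (\<Sum>J\<in>S. a J * rot L F k J * exp (2 * of_real pi * \<i> * of_int (F J) * of_real t)) powr p" for t
    unfolding \<phi>_def h_def rt[symmetric] by (simp only: mult.assoc)
  have "Lp_pow p (\<lambda>t. \<Sum>J\<in>S. a J * rot L F k J * trig (F J) t) = (LINT t|leb01. \<phi> (t + r))"
    unfolding Lp_pow_def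
    by (rule Bochner_Integration.integral_cong[OF refl])
       (simp add: space_restrict_space trig_def \<phi>r)
  also have "\<dots> = integral {0..1} \<phi>"
    unfolding integral_leb01[OF cont'] by (rule integral_periodic[OF cont per]) (simp add: r_def)
  also have "\<dots> = (LINT t|leb01. \<phi> t)" by (rule integral_leb01[OF cont, symmetric])
  also have "\<dots> = Lp_pow p (\<lambda>t. \<Sum>J\<in>S. a J * trig (F J) t)"
    unfolding Lp_pow_def
    by (rule Bochner_Integration.integral_cong[OF refl])
       (simp add: space_restrict_space trig_def \<phi>_def h_def)
  finally show ?thesis .
qed

section \<open>Transfer of norm estimates through an isomorphism\<close>

lemma zero_in_Lp_fun: "(\<lambda>_. 0) \<in> Lp_fun p"
  by (simp add: Lp_fun_def)

lemma Lp_fun_sum: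
  assumes "p > 0" "finite S" "\<And>i. i \<in> S \<Longrightarrow> f i \<in> Lp_fun p"
  shows "(\<lambda>t. \<Sum>i\<in>S. a i * f i t) \<in> Lp_fun p"
  using assms(2,3)
proof (induction S)
  case (insert i S)
  thus ?case using Lp_fun_add[OF assms(1) Lp_fun_scale[of "f i" p "a i"]] by simp
qed (simp add: zero_in_Lp_fun)

lemma Lp_linear_sum:
  assumes T: "Lp_linear p T" and p: "p > 0" and S: "finite S"
    and f: "\<And>i. i \<in> S \<Longrightarrow> f i \<in> Lp_fun p" and g: "\<And>i. i \<in> S \<Longrightarrow> g i \<in> Lp_fun p"
    and fg: "\<And>i. i \<in> S \<Longrightarrow> T (Lp_class p (f i)) = Lp_class p (g i)"
  shows "T (Lp_class p (\<lambda>t. \<Sum>i\<in>S. a i * f i t)) = Lp_class p (\<lambda>t. \<Sum>i\<in>S. a i * g i t)"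
  using S f g fg
proof (induction S)
  case empty
  \<comment> \<open>\<open>T\<close> fixes the zero class because it commutes with scaling by
    0.\<close>
  have z: "Lp_class p (\<lambda>_. 0) \<in> Lp p" by (intro Lp_class_in_Lp zero_in_Lp_fun)
  hence "T (Lp_class p (\<lambda>_. 0)) \<in> Lp p" using T by (auto simp: Lp_linear_def)
  then obtain h where h: "h \<in> Lp_fun p" "T (Lp_class p (\<lambda>_. 0)) = Lp_class p h" by (rule Lp_classE)
  have "T (Lp_scale p 0 (Lp_class p (\<lambda>_. 0))) = Lp_scale p 0 (T (Lp_class p (\<lambda>_. 0)))"
    using T z by (simp add: Lp_linear_def)
  thus ?case by (simp add: h Lp_scale_class[OF zero_in_Lp_fun] Lp_scale_class)
next
  case (insert i S)
  let ?F = "\<lambda>t. \<Sum>i\<in>S. a i * f i t" and ?G = "\<lambda>t. \<Sum>i\<in>S. a i * g i t"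
  have F: "?F \<in> Lp_fun p" "?G \<in> Lp_fun p" using insert by (auto intro!: Lp_fun_sum p)
  have i: "f i \<in> Lp_fun p" "g i \<in> Lp_fun p" "T (Lp_class p (f i)) = Lp_class p (g i)"
    using insert by auto
  have "Lp_class p (\<lambda>t. \<Sum>j\<in>insert i S. a j * f j t) = Lp_add p (Lp_scale p (a i) (Lp_class p (f i))) (Lp_class p ?F)"
    using insert.hyps F i by (simp add: Lp_scale_class Lp_add_class[OF p] Lp_fun_scale)
  also have "T \<dots> = Lp_add p (T (Lp_scale p (a i) (Lp_class p (f i)))) (T (Lp_class p ?F))"
    using T F i Lp_class_in_Lp[OF Lp_fun_scale[OF i(1)], of "a i"]
    by (simp add: Lp_linear_def Lp_class_in_Lp Lp_scale_class)
  also have "T (Lp_scale p (a i) (Lp_class p (f i))) = Lp_scale p (a i) (Lp_class p (g i))"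
    using T i by (simp add: Lp_linear_def Lp_class_in_Lp)
  also have "T (Lp_class p ?F) = Lp_class p ?G" using insert by auto
  also have "Lp_add p (Lp_scale p (a i) (Lp_class p (g i))) (Lp_class p ?G) = Lp_class p (\<lambda>t. \<Sum>j\<in>insert i S. a j * g j t)"
    using insert.hyps F i by (simp add: Lp_scale_class Lp_add_class[OF p] Lp_fun_scale)
  finally show ?case .
qed

text \<open>The constant from boundedness may be negative; \<open>max C 0\<close> keeps the bases
  nonnegative, where \<open>powr\<close> is monotone.\<close>

lemma powr_bound:
  fixes x y p C :: real
  assumes p: "p > 0" and "x \<ge> 0" "y \<ge> 0" and "x powr (1 / p) \<le> C * y powr (1 / p)"
  shows "x \<le> max C 0 powr p * y"
proof -
  have "x = (x powr (1 / p)) powr p" using p \<open>x \<ge> 0\<close> by (simp add: powr_powr)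
  also have "\<dots> \<le> (max C 0 * y powr (1 / p)) powr p"
  proof (rule powr_mono2)
    show "x powr (1 / p) \<le> max C 0 * y powr (1 / p)"
      using assms(4) by (rule order_trans) (simp add: mult_right_mono)
  qed (use p in auto)
  also have "\<dots> = max C 0 powr p * y" using p \<open>y \<ge> 0\<close> by (simp add: powr_mult powr_powr)
  finally show ?thesis .
qed

text \<open>One estimate comes from \<open>T\<close>, the other from its inverse. Arbitrary families
  related by \<open>T\<close> let both directions of \<sigma> use it.\<close>

lemma isomorphism_Lp_pow_equiv:
  assumes T: "Lp_isomorphism p T" and p: "p > 0"
  obtains K where "\<And>S a f g. finite S \<Longrightarrow> (\<And>i :: 'i. i \<in> S \<Longrightarrow> f i \<in> Lp_fun p) \<Longrightarrow> (\<And>i. i \<in> S \<Longrightarrow> g i \<in> Lp_fun p)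
     \<Longrightarrow> (\<And>i. i \<in> S \<Longrightarrow> T (Lp_class p (f i)) = Lp_class p (g i)) \<Longrightarrow>
     Lp_pow p (\<lambda>t. \<Sum>i\<in>S. a i * g i t) \<le> K * Lp_pow p (\<lambda>t. \<Sum>i\<in>S. a i * f i t) \<and>
     Lp_pow p (\<lambda>t. \<Sum>i\<in>S. a i * f i t) \<le> K * Lp_pow p (\<lambda>t. \<Sum>i\<in>S. a i * g i t)" "K \<ge> 0"
proof -
  obtain C1 C2 where C1: "\<And>A. A \<in> Lp p \<Longrightarrow> Lp_norm p (T A) \<le> C1 * Lp_norm p A"
    and C2: "\<And>A. A \<in> Lp p \<Longrightarrow> Lp_norm p (inv_into (Lp p) T A) \<le> C2 * Lp_norm p A"
    using T unfolding Lp_isomorphism_def Lp_bounded_def by blast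
  define K where "K = max (max C1 0 powr p) (max C2 0 powr p)"
  have nn: "Lp_pow p f \<ge> 0" for f by (simp add: Lp_pow_def)
  show ?thesis
  proof (rule that[of K])
    show "K \<ge> 0" by (simp add: K_def le_max_iff_disj)
    fix S a and f g :: "'i \<Rightarrow> real \<Rightarrow> complex"
    assume S: "finite S" and f: "\<And>i. i \<in> S \<Longrightarrow> f i \<in> Lp_fun p" and g: "\<And>i. i \<in> S \<Longrightarrow> g i \<in> Lp_fun p"
      and fg: "\<And>i. i \<in> S \<Longrightarrow> T (Lp_class p (f i)) = Lp_class p (g i)"
    let ?F = "\<lambda>t. \<Sum>i\<in>S. a i * f i t" and ?G = "\<lambda>t. \<Sum>i\<in>S. a i * g i t"
    have F: "?F \<in> Lp_fun p" and G: "?G \<in> Lp_fun p" using Lp_fun_sum[OF p S] f g by auto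
    have TF: "T (Lp_class p ?F) = Lp_class p ?G"
      using T by (intro Lp_linear_sum p S f g fg) (simp_all add: Lp_isomorphism_def)
    have "inj_on T (Lp p)" using T by (auto simp: Lp_isomorphism_def bij_betw_def)
    hence inv: "inv_into (Lp p) T (Lp_class p ?G) = Lp_class p ?F"
      unfolding TF[symmetric] using F by (intro inv_into_f_f Lp_class_in_Lp)
    have "Lp_pow p ?G \<le> max C1 0 powr p * Lp_pow p ?F"
      using C1[OF Lp_class_in_Lp[OF F]] unfolding TF Lp_norm_class[OF F] Lp_norm_class[OF G] Lp_pow_def[symmetric]
      by (intro powr_bound p nn)
    moreover have "Lp_pow p ?F \<le> max C2 0 powr p * Lp_pow p ?G"
      using C2[OF Lp_class_in_Lp[OF G]] unfolding inv Lp_norm_class[OF F] Lp_norm_class[OF G] Lp_pow_def[symmetric]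
      by (intro powr_bound p nn)
    moreover have "max C1 0 powr p * Lp_pow p ?F \<le> K * Lp_pow p ?F" "max C2 0 powr p * Lp_pow p ?G \<le> K * Lp_pow p ?G"
      using nn by (auto intro!: mult_right_mono simp: K_def)
    ultimately show "Lp_pow p ?G \<le> K * Lp_pow p ?F \<and> Lp_pow p ?F \<le> K * Lp_pow p ?G" by linarith
  qed
qed

section \<open>Incompatibility of the Walsh and trigonometric systems\<close>

lemma trig_in_Lp_fun: "trig z \<in> Lp_fun p"
  using trig_functions_subset by (auto simp: trig_functions_def)

lemma walsh_in_Lp_fun: "finite J \<Longrightarrow> walsh J \<in> Lp_fun p"
  using walsh_functions_subset by (auto simp: walsh_functions_def)

text \<open>By injectivity the numbers \<open>2 * (F J - F K)\<close> are nonzero, so any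
  \<open>L\<close> above all their absolute values divides none of them.\<close>

lemma separated_exists:
  assumes I: "finite I" and inj: "inj_on F (Pow I)"
  shows "\<exists>L>0. separated L I F"
proof -
  define M where "M = (\<Sum>J\<in>Pow I. \<Sum>K\<in>Pow I. \<bar>2 * (F J - F K)\<bar>)"
  have M: "\<bar>2 * (F J - F K)\<bar> \<le> M" if "J \<subseteq> I" "K \<subseteq> I" for J K
  proof -
    have "\<bar>2 * (F J - F K)\<bar> \<le> (\<Sum>K\<in>Pow I. \<bar>2 * (F J - F K)\<bar>)"
      using that I by (intro member_le_sum[of K "Pow I" "\<lambda>K. \<bar>2 * (F J - F K)\<bar>"]) auto
    also have "\<dots> \<le> M" unfolding M_def
      using that I by (intro member_le_sum[of J "Pow I" "\<lambda>J. \<Sum>K\<in>Pow I. \<bar>2 * (F J - F K)\<bar>"]) (auto intro: sum_nonneg)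
    finally show ?thesis .
  qed
  have "M \<ge> 0" unfolding M_def by (intro sum_nonneg) auto
  have "separated (nat (M + 1)) I F"
    unfolding separated_def
  proof (intro allI impI notI)
    fix J K assume JK: "J \<subseteq> I" "K \<subseteq> I" "J \<noteq> K" and d: "int (nat (M + 1)) dvd 2 * (F J - F K)"
    have "F J \<noteq> F K" using inj_onD[OF inj, of J K] JK by auto
    hence "\<bar>int (nat (M + 1))\<bar> \<le> \<bar>2 * (F J - F K)\<bar>" by (intro dvd_imp_le_int d) simp
    thus False using M[OF JK(1,2)] \<open>M \<ge> 0\<close> by simp
  qed
  thus ?thesis using \<open>M \<ge> 0\<close> by (intro exI[of _ "nat (M + 1)"]) auto
qed

text \<open>Passing from Walsh to trigonometric sums and back costs a factor \<open>K\<close> each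
  way, and the rotation in between costs nothing. So rotations are Walsh multipliers with constant
  \<open>K * K\<close> in every dimension, which is impossible.\<close>

lemma walsh_trig_not_equivalent:
  assumes p: "1 < p" "p \<noteq> 2" and F: "inj_on F {J. finite J}" and K: "K \<ge> 0"
    and eq1: "\<And>S a. finite S \<Longrightarrow> S \<subseteq> {J. finite J} \<Longrightarrow>
      Lp_pow p (\<lambda>t. \<Sum>J\<in>S. a J * walsh J t) \<le> K * Lp_pow p (\<lambda>t. \<Sum>J\<in>S. a J * trig (F J) t)"
    and eq2: "\<And>S a. finite S \<Longrightarrow> S \<subseteq> {J. finite J} \<Longrightarrow>
      Lp_pow p (\<lambda>t. \<Sum>J\<in>S. a J * trig (F J) t) \<le> K * Lp_pow p (\<lambda>t. \<Sum>J\<in>S. a J * walsh J t)"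
  shows False
proof -
  obtain N where N: "\<And>L I (F :: nat set \<Rightarrow> int). finite I \<Longrightarrow> L > 0 \<Longrightarrow> separated L I F \<Longrightarrow>
    multiplier_bound p (K * K) L I F \<Longrightarrow> card I < N"
    using multiplier_dimension_bounded[OF p, of "K * K"] by blast
  \<comment> \<open>The smallest dimension excluded by the bound.\<close>
  let ?I = "{..<N}"
  have S: "finite (Pow ?I)" "Pow ?I \<subseteq> {J. finite J}" using finite_subset by auto
  obtain L where L: "L > 0" "separated L ?I F"
    using separated_exists[of ?I F] inj_on_subset[OF F S(2)] by auto
  have "multiplier_bound p (K * K) L ?I F"
    unfolding multiplier_bound_def
  proof (intro allI)
    fix k and a :: "nat set \<Rightarrow> complex"
    have "Lp_pow p (\<lambda>t. \<Sum>J\<in>Pow ?I. (a J * rot L F k J) * walsh J t)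
        \<le> K * Lp_pow p (\<lambda>t. \<Sum>J\<in>Pow ?I. a J * rot L F k J * trig (F J) t)"
      by (rule eq1[OF S])
    also have "\<dots> = K * Lp_pow p (\<lambda>t. \<Sum>J\<in>Pow ?I. a J * trig (F J) t)"
      using Lp_pow_trig_rot[OF S(1) L(1), of p a F k] p by simp
    also have "\<dots> \<le> K * (K * Lp_pow p (\<lambda>t. \<Sum>J\<in>Pow ?I. a J * walsh J t))"
      by (intro mult_left_mono eq2[OF S] K)
    finally show "(\<Sum>x\<in>Pow ?I. cmod (\<Sum>J\<in>Pow ?I. a J * rot L F k J * wal x J) powr p)
       \<le> K * K * (\<Sum>x\<in>Pow ?I. cmod (\<Sum>J\<in>Pow ?I. a J * wal x J) powr p)"
      unfolding Lp_pow_walsh by (simp add: field_simps)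
  qed
  hence "card ?I < N" by (intro N[OF _ L]) auto
  thus False by simp
qed

theorem theorem1p1:
  fixes p :: real
    and D E :: "(real \<Rightarrow> complex) set"
    and \<sigma> :: "(real \<Rightarrow> complex) \<Rightarrow> (real \<Rightarrow> complex)"
  assumes "1 < p" and "p \<noteq> 2"
    and "(D = trig_functions \<and> E = walsh_functions) \<or>
         (D = walsh_functions \<and> E = trig_functions)"
    and "bij_betw \<sigma> D E"
  shows "\<not> (\<exists>T. Lp_isomorphism p T \<and> (\<forall>f\<in>D. T (Lp_class p f) = Lp_class p (\<sigma> f)))"
proof
  assume "\<exists>T. Lp_isomorphism p T \<and> (\<forall>f\<in>D. T (Lp_class p f) = Lp_class p (\<sigma> f))"
  then obtain T where T: "Lp_isomorphism p T" "\<And>f. f \<in> D \<Longrightarrow> T (Lp_class p f) = Lp_class p (\<sigma> f)" by blast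
  have p0: "p > 0" using assms(1) by simp
  obtain K where K: "\<And>S a f g. finite S \<Longrightarrow> (\<And>i :: nat set. i \<in> S \<Longrightarrow> f i \<in> Lp_fun p) \<Longrightarrow> (\<And>i. i \<in> S \<Longrightarrow> g i \<in> Lp_fun p)
     \<Longrightarrow> (\<And>i. i \<in> S \<Longrightarrow> T (Lp_class p (f i)) = Lp_class p (g i)) \<Longrightarrow>
     Lp_pow p (\<lambda>t. \<Sum>i\<in>S. a i * g i t) \<le> K * Lp_pow p (\<lambda>t. \<Sum>i\<in>S. a i * f i t) \<and>
     Lp_pow p (\<lambda>t. \<Sum>i\<in>S. a i * f i t) \<le> K * Lp_pow p (\<lambda>t. \<Sum>i\<in>S. a i * g i t)" "K \<ge> 0"
    using isomorphism_Lp_pow_equiv[OF T(1) p0] by blast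
  from assms(3) show False
  proof
    assume DE: "D = trig_functions \<and> E = walsh_functions"
    \<comment> \<open>Surjectivity of \<sigma> supplies a frequency for each Walsh function;
      distinct Walsh functions get distinct frequencies because \<sigma> is a function.\<close>
    have "\<exists>z. \<sigma> (trig z) = walsh J" if "finite J" for J
    proof -
      have "walsh J \<in> \<sigma> ` D" using that assms(4) DE by (auto simp: bij_betw_def walsh_functions_def)
      thus ?thesis using DE by (auto simp: trig_functions_def)
    qed
    then obtain F where F: "\<And>J. finite J \<Longrightarrow> \<sigma> (trig (F J)) = walsh J" by metis
    have TF: "T (Lp_class p (trig (F J))) = Lp_class p (walsh J)" if "finite J" for J
      using T(2)[of "trig (F J)"] F[OF that] DE by (auto simp: trig_functions_def)
    show False
    proof (rule walsh_trig_not_equivalent[OF assms(1,2) _ K(2)])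
      show "inj_on F {J. finite J}"
        by (intro inj_onI walsh_inj) (auto simp flip: F)
    next
      fix S :: "nat set set" and a :: "nat set \<Rightarrow> complex"
      assume S: "finite S" "S \<subseteq> {J. finite J}"
      note * = K(1)[OF S(1), of "\<lambda>J. trig (F J)" walsh a]
      show "Lp_pow p (\<lambda>t. \<Sum>J\<in>S. a J * walsh J t) \<le> K * Lp_pow p (\<lambda>t. \<Sum>J\<in>S. a J * trig (F J) t)"
        "Lp_pow p (\<lambda>t. \<Sum>J\<in>S. a J * trig (F J) t) \<le> K * Lp_pow p (\<lambda>t. \<Sum>J\<in>S. a J * walsh J t)"
        using * S(2) TF by (auto simp: trig_in_Lp_fun walsh_in_Lp_fun subset_iff)
    qed
  next
    assume DE: "D = walsh_functions \<and> E = trig_functions"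
    \<comment> \<open>In this direction \<open>F\<close> is read off from the values of \<sigma> and
      is injective because \<sigma> is.\<close>
    have "\<exists>z. \<sigma> (walsh J) = trig z" if "finite J" for J
    proof -
      have "\<sigma> (walsh J) \<in> E" using that assms(4) DE by (auto simp: bij_betw_def walsh_functions_def)
      thus ?thesis using DE by (auto simp: trig_functions_def)
    qed
    then obtain F where F: "\<And>J. finite J \<Longrightarrow> \<sigma> (walsh J) = trig (F J)" by metis
    have TF: "T (Lp_class p (walsh J)) = Lp_class p (trig (F J))" if "finite J" for J
      using T(2)[of "walsh J"] F[OF that] DE that by (auto simp: walsh_functions_def)
    show False
    proof (rule walsh_trig_not_equivalent[OF assms(1,2) _ K(2)])
      show "inj_on F {J. finite J}"
      proof (intro inj_onI walsh_inj)
        fix J J' assume J: "J \<in> {J. finite J}" "J' \<in> {J. finite J}" "F J = F J'"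
        hence "\<sigma> (walsh J) = \<sigma> (walsh J')" using F by simp
        thus "walsh J = walsh J'" using assms(4) DE J by (auto simp: bij_betw_def walsh_functions_def dest!: inj_onD)
      qed auto
    next
      fix S :: "nat set set" and a :: "nat set \<Rightarrow> complex"
      assume S: "finite S" "S \<subseteq> {J. finite J}"
      note * = K(1)[OF S(1), of walsh "\<lambda>J. trig (F J)" a]
      show "Lp_pow p (\<lambda>t. \<Sum>J\<in>S. a J * walsh J t) \<le> K * Lp_pow p (\<lambda>t. \<Sum>J\<in>S. a J * trig (F J) t)"
        "Lp_pow p (\<lambda>t. \<Sum>J\<in>S. a J * trig (F J) t) \<le> K * Lp_pow p (\<lambda>t. \<Sum>J\<in>S. a J * walsh J t)"
        using * S(2) TF by (auto simp: trig_in_Lp_fun walsh_in_Lp_fun subset_iff)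
    qed
  qed
qed

end
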